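(* Let $K$ be a subgroup of finite index of $G_5$ with geometric level $m$. Then: (i) Suppose that $m\not\equiv 0\pmod 4$. Then $K$ is a congruence subgroup if and only if $G(m)\subseteq K$. (ii) Suppose that $4\mid m$. Then $K$ is a congruence subgroup if and only if $G(2m)\subseteq K$.
   Context: Let $\lambda=2\cos(\pi/5)$ (so $\lambda^2=\lambda+1$). The homogeneous Hecke group $H_5$ is the subgroup of $SL(2,\mathbb{Z}[\lambda])$ generated by $T=\begin{pmatrix}1&\lambda\\0&1\end{pmatrix}$ and $S=\begin{pmatrix}0&1\\-1&0\end{pmatrix}$. Put $Z=\langle\pm I\rangle$. For $\tau\in\mathbb{Z}[\lambda]$ let $H(\tau)=\{A\in H_5 : A\equiv I \pmod{\tau}\}$ (entrywise congruence in $\mathbb{Z}[\lambda]$). The inhomogeneous Hecke group is $G_5=H_5/Z$, and its principal congruence subgroups are $G(\tau)=H(\tau)Z/Z$; thus in $G_5$ a matrix is identified with its negative. A subgroup $K$ of $G_5$ is a congruence subgroup if $G(\tau)\subseteq K$ for some nonzero $\tau\in\mathbb{Z}[\lambda]$. The cusps are the points of the $G_5$-orbit of $\infty$ under Möbius transformations. The width (with respect to $K$) of a cusp $x$ is the smallest positive integer $w$ such that $\pm T^w$ is conjugate in $G_5$ to an element of $K$ fixing $x$. The geometric level of $K$ is the least common multiple of the widths (with respect to $K$) of all cusps. *)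

theory Defs
  imports
    "HOL-Analysis.Determinants"
    "HOL-Algebra.Coset"
    "HOL-Algebra.Elementary_Groups"
    "HOL-Computational_Algebra.Polynomial"
begin

definition lam :: real where
  "lam = 2 * cos (pi / 5)"

definition Zlam :: "real set" where
  "Zlam = range (\<lambda>p :: int poly. poly (map_poly of_int p) lam)"

definition SL2_Zlam :: "(real^2^2) monoid" where
  "SL2_Zlam = \<lparr>carrier = {A. (\<forall>i j. A $ i $ j \<in> Zlam) \<and> det A = 1}, monoid.mult = (**), one = mat 1\<rparr>"

definition T_mat :: "real^2^2" where
  "T_mat = vector [vector [1, lam], vector [0, 1]]"

definition S_mat :: "real^2^2" where
  "S_mat = vector [vector [0, 1], vector [-1, 0]]"

definition H5 :: "(real^2^2) monoid" where
  "H5 = subgroup_generated SL2_Zlam {T_mat, S_mat}"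

definition Z_pm :: "(real^2^2) set" where
  "Z_pm = {mat 1, - mat 1}"

definition G5 :: "(real^2^2) set monoid" where
  "G5 = H5 Mod Z_pm"

definition pm :: "real^2^2 \<Rightarrow> (real^2^2) set" where
  "pm A = Z_pm #>\<^bsub>H5\<^esub> A"

definition H_cong :: "real \<Rightarrow> (real^2^2) set" where
  "H_cong \<tau> = {A \<in> carrier H5. \<forall>i j. \<exists>c \<in> Zlam. A $ i $ j - mat 1 $ i $ j = \<tau> * c}"

definition G_cong :: "real \<Rightarrow> (real^2^2) set set" where
  "G_cong \<tau> = pm ` (H_cong \<tau> <#>\<^bsub>H5\<^esub> Z_pm)"

definition congruence_subgroup :: "(real^2^2) set set \<Rightarrow> bool" where
  "congruence_subgroup K \<longleftrightarrow> subgroup K G5 \<and> (\<exists>\<tau> \<in> Zlam. \<tau> \<noteq> 0 \<and> G_cong \<tau> \<subseteq> K)"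

text \<open>Points of the real projective line are values of type \<open>real option\<close>, with \<open>None\<close> for the
  point at infinity.\<close>

fun moebius_act :: "real^2^2 \<Rightarrow> real option \<Rightarrow> real option" where
  "moebius_act A (Some x) =
     (if A $ 2 $ 1 * x + A $ 2 $ 2 = 0 then None
      else Some ((A $ 1 $ 1 * x + A $ 1 $ 2) / (A $ 2 $ 1 * x + A $ 2 $ 2)))"
| "moebius_act A None =
     (if A $ 2 $ 1 = 0 then None else Some (A $ 1 $ 1 / A $ 2 $ 1))"

text \<open>A matrix and its negative act alike, so the action descends to \<open>G5\<close>; it is expressed
  through the representatives of a coset.\<close>

definition cusps :: "real option set" where
  "cusps = {moebius_act A None | A X. X \<in> carrier G5 \<and> A \<in> X}"

definition fixes_point :: "(real^2^2) set \<Rightarrow> real option \<Rightarrow> bool" where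
  "fixes_point X x \<longleftrightarrow> (\<forall>A \<in> X. moebius_act A x = x)"

definition width :: "(real^2^2) set set \<Rightarrow> real option \<Rightarrow> nat" where
  "width K x = (LEAST w. w > 0 \<and>
     (\<exists>g \<in> carrier G5. \<exists>k \<in> K. fixes_point k x \<and>
        k = g \<otimes>\<^bsub>G5\<^esub> (pm T_mat [^]\<^bsub>G5\<^esub> w) \<otimes>\<^bsub>G5\<^esub> inv\<^bsub>G5\<^esub> g))"

text \<open>For \<open>K\<close> of finite index the widths are bounded, so this is the least common multiple of a
  finite set of positive integers (\<open>Lcm\<close> of an infinite set of naturals would be 0).\<close>

definition geometric_level :: "(real^2^2) set set \<Rightarrow> nat" where
  "geometric_level K = Lcm (width K ` cusps)"

end

theory Submission
  imports Defs "HOL-Computational_Algebra.Primes"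
begin

text \<open>Let \<open>N(n)\<close> be the normal closure of \<open>T\<^sup>n\<close> in \<open>H\<^sub>5\<close>. If \<open>m\<close> is the geometric level of \<open>K\<close>,
  the preimage of \<open>K\<close> contains \<open>N(m)\<close>: a nonzero entry of an element of \<open>H\<^sub>5\<close> has absolute value at
  least 1, so the stabiliser of infinity is unipotent up to sign and widths do not depend on the
  conjugator. It remains to see, for all \<open>M > 0\<close>, that \<open>H(m) \<subseteq> N(m) H(mM)\<close> if 4 does not divide \<open>m\<close>
  and that \<open>H(2m) \<subseteq> N(m) H(2mM)\<close> otherwise.

  For \<open>M\<close> coprime to \<open>m\<close>, write an element as a product of conjugates of powers of \<open>T\<close>
  (\<open>N(1) = H\<^sub>5\<close>) and multiply all exponents by some \<open>e\<close> with \<open>e \<equiv> 0 (mod m)\<close> and \<open>e \<equiv> 1 (mod M)\<close>.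
  The same trick applied to \<open>H(2) = N(2)\<close> gives the powers of 2 when \<open>m\<close> is twice an odd number. In
  all other cases one climbs the filtration: modulo \<open>n\<^sup>2\<close> a product of conjugates of powers of
  \<open>T\<^sup>n\<close> is \<open>I + n X\<close> with \<open>X\<close> in the lattice spanned by the conjugates of \<open>T - I\<close>, and this lattice
  contains twice every trace zero matrix over \<open>\<int>[\<lambda>]\<close>.\<close>

section \<open>The ring \<open>\<int>[\<lambda>]\<close> and the group \<open>H\<^sub>5\<close>\<close>

text \<open>For the angle pi/5 the relation cos 3t = - cos 2t is a cubic equation in c = cos t with
  the factor c + 1, which is discarded because c > 0.\<close>

lemma lam_sq: "lam * lam = lam + 1"
proof -
  define c where "c = cos (pi / 5)"
  have "cos (3 * (pi / 5)) = - cos (2 * (pi / 5))"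
    using cos_minus_pi[of "3 * (pi / 5)"] cos_minus[of "2 * (pi / 5)"] by (simp add: field_simps)
  then have "4 * c ^ 3 - 3 * c = - (2 * c\<^sup>2 - 1)"
    unfolding c_def by (simp only: cos_treble_cos cos_double_cos)
  then have "(c + 1) * (4 * c\<^sup>2 - 2 * c - 1) = 0"
    by (simp add: algebra_simps power2_eq_square power3_eq_cube)
  moreover have "c > 0"
    unfolding c_def by (rule cos_gt_zero) auto
  ultimately have "4 * c\<^sup>2 - 2 * c - 1 = 0" by simp
  then show ?thesis
    by (simp add: lam_def c_def power2_eq_square algebra_simps)
qed

lemma lam_gt_1: "lam > 1"
proof -
  have "lam > 0"
    unfolding lam_def using cos_gt_zero[of "pi / 5"] by simp
  then show ?thesis
    using lam_sq by (metis add_le_cancel_left less_add_one linorder_not_less mult_left_le order_less_imp_le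
        order_le_less_trans add.commute)
qed

text \<open>In lowest terms p/q the quadratic equation forces q = 1, and then p (p - 1) = 1 fails by
  parity.\<close>

lemma lam_irrational: "lam \<notin> \<rat>"
proof
  assume "lam \<in> \<rat>"
  then obtain p q :: int where q: "q > 0" "coprime p q" and l: "lam = of_int p / of_int q"
    by (metis Rats_cases')
  have "(of_int p :: real) * of_int p = of_int p * of_int q + of_int q * of_int q"
    using lam_sq q(1) unfolding l by (simp add: field_simps)
  then have eq: "p * p = q * (p + q)"
    by (simp add: algebra_simps flip: of_int_mult of_int_add)
  then have "q dvd p * p" by simp
  then have "q dvd 1"
    using q(2) by (metis coprime_commute coprime_dvd_mult_left_iff coprime_def dvd_refl)
  then have "q = 1" using q(1) by auto
  then have "p * (p - 1) = 1" using eq by (simp add: algebra_simps)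
  moreover have "even (p * (p - 1))" by simp
  ultimately show False by simp
qed

lemma Zlam_iff: "x \<in> Zlam \<longleftrightarrow> (\<exists>a b :: int. x = of_int a + of_int b * lam)"
proof
  assume "x \<in> Zlam"
  then obtain p :: "int poly" where x: "x = poly (map_poly of_int p) lam"
    by (auto simp: Zlam_def)
  have "\<exists>a b :: int. poly (map_poly of_int p) lam = of_int a + of_int b * lam"
  proof (induction p)
    case 0
    show ?case by (rule exI[of _ 0], rule exI[of _ 0]) simp
  next
    case (pCons c p)
    then obtain a b :: int where "poly (map_poly of_int p) lam = of_int a + of_int b * lam" by blast
    moreover have "lam * (of_int a + of_int b * lam) = of_int a * lam + of_int b * (lam + 1)"
      by (simp add: algebra_simps flip: lam_sq)
    ultimately show ?case using pCons(1)
      by (intro exI[of _ "c + b"] exI[of _ "a + b"]) (simp add: map_poly_pCons algebra_simps)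
  qed
  then show "\<exists>a b :: int. x = of_int a + of_int b * lam" using x by simp
next
  assume "\<exists>a b :: int. x = of_int a + of_int b * lam"
  then obtain a b :: int where "x = of_int a + of_int b * lam" by blast
  then have "x = poly (map_poly of_int [:a, b:]) lam" by (simp add: map_poly_pCons algebra_simps)
  then show "x \<in> Zlam" unfolding Zlam_def by blast
qed

lemma Zlam_lincomb [simp]: "of_int a + of_int b * lam \<in> Zlam"
  using Zlam_iff by blast

lemma Zlam_of_int [simp]: "of_int a \<in> Zlam"
  using Zlam_lincomb[of a 0] by simp

lemma Zlam_0 [simp]: "0 \<in> Zlam" and Zlam_1 [simp]: "1 \<in> Zlam" and Zlam_numeral [simp]: "numeral k \<in> Zlam"
  and Zlam_lam [simp]: "lam \<in> Zlam"
  using Zlam_of_int[of 0] Zlam_of_int[of 1] Zlam_of_int[of "numeral k"] Zlam_lincomb[of 0 1] by simp_all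

lemma Zlam_add [simp]: "x \<in> Zlam \<Longrightarrow> y \<in> Zlam \<Longrightarrow> x + y \<in> Zlam"
proof -
  assume "x \<in> Zlam" "y \<in> Zlam"
  then obtain a b c d :: int where "x = of_int a + of_int b * lam" "y = of_int c + of_int d * lam"
    unfolding Zlam_iff by blast
  then have "x + y = of_int (a + c) + of_int (b + d) * lam" by (simp add: algebra_simps)
  then show ?thesis by (simp only: Zlam_lincomb)
qed

lemma Zlam_minus [simp]: "x \<in> Zlam \<Longrightarrow> - x \<in> Zlam"
proof -
  assume "x \<in> Zlam"
  then obtain a b :: int where "x = of_int a + of_int b * lam"
    unfolding Zlam_iff by blast
  then have "- x = of_int (- a) + of_int (- b) * lam" by simp
  then show ?thesis by (simp only: Zlam_lincomb)
qed

lemma Zlam_diff [simp]: "x \<in> Zlam \<Longrightarrow> y \<in> Zlam \<Longrightarrow> x - y \<in> Zlam"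
  using Zlam_add[of x "- y"] by simp

lemma Zlam_mult [simp]: "x \<in> Zlam \<Longrightarrow> y \<in> Zlam \<Longrightarrow> x * y \<in> Zlam"
proof -
  assume "x \<in> Zlam" "y \<in> Zlam"
  then obtain a b c d :: int where x: "x = of_int a + of_int b * lam" and y: "y = of_int c + of_int d * lam"
    unfolding Zlam_iff by blast
  have "x * y = of_int a * of_int c + (of_int a * of_int d + of_int b * of_int c) * lam
      + of_int b * of_int d * (lam * lam)"
    unfolding x y by (simp add: algebra_simps)
  also have "\<dots> = of_int (a * c + b * d) + of_int (a * d + b * c + b * d) * lam"
    unfolding lam_sq by (simp add: algebra_simps)
  finally show ?thesis by (simp only: Zlam_lincomb)
qed

lemma Zlam_lincomb_eq_0: "of_int a + of_int b * lam = 0 \<Longrightarrow> a = 0 \<and> b = 0"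
proof -
  assume *: "of_int a + of_int b * lam = 0"
  have "b = 0"
  proof (rule ccontr)
    assume "b \<noteq> 0"
    then have "lam = - of_int a / of_int b" using * by (simp add: field_simps)
    then have "lam = of_int (- a) / of_int b" by simp
    then have "lam \<in> \<rat>" by (metis Rats_divide Rats_of_int)
    then show False using lam_irrational by blast
  qed
  then show ?thesis using * by simp
qed

text \<open>So 2 is not a unit of the ring; this separates residue classes modulo 2 below.\<close>

lemma one_not_double_Zlam: "c \<in> Zlam \<Longrightarrow> 1 \<noteq> 2 * c"
proof
  assume "c \<in> Zlam" and *: "1 = 2 * c"
  then obtain a b :: int where c: "c = of_int a + of_int b * lam" unfolding Zlam_iff by blast
  have "of_int (2 * a - 1) + of_int (2 * b) * lam = 0" using * c by simp
  then have "2 * a - 1 = 0" using Zlam_lincomb_eq_0 by blast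
  then show False by presburger
qed

text \<open>The product of \<open>a + b \<lambda>\<close> with its Galois conjugate \<open>a + b - b \<lambda>\<close> is the norm.\<close>

lemma Zlam_int_multiple:
  assumes "\<tau> \<in> Zlam" "\<tau> \<noteq> 0"
  shows "\<exists>M c. (M :: int) > 0 \<and> c \<in> Zlam \<and> of_int M = \<tau> * c"
proof -
  obtain a b :: int where t: "\<tau> = of_int a + of_int b * lam" using assms unfolding Zlam_iff by blast
  define c where "c = of_int (a + b) + of_int (- b) * lam"
  define N where "N = a * a + a * b - b * b"
  have c: "c \<in> Zlam" by (simp only: c_def Zlam_lincomb)
  have "\<tau> * c = of_int (a * a + a * b) + of_int (b * b) * (lam - lam * lam)"
    unfolding t c_def by (simp add: algebra_simps)
  then have N: "\<tau> * c = of_int N" unfolding lam_sq N_def by simp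
  have "c \<noteq> 0"
  proof
    assume "c = 0"
    then have "a + b = 0 \<and> - b = 0" unfolding c_def by (rule Zlam_lincomb_eq_0)
    then show False using assms t by simp
  qed
  then have "N \<noteq> 0" using N assms by auto
  then show ?thesis using N c
    by (cases "N > 0") (force intro!: exI[of _ "N"], force intro!: exI[of _ "-N"] exI[of _ "-c"])
qed

section \<open>Two by two matrices in coordinates\<close>

definition mk2 :: "real \<Rightarrow> real \<Rightarrow> real \<Rightarrow> real \<Rightarrow> real^2^2" where
  "mk2 a b c d = vector [vector [a, b], vector [c, d]]"

lemma mk2_nth [simp]: "mk2 a b c d $ 1 $ 1 = a" "mk2 a b c d $ 1 $ 2 = b"
  "mk2 a b c d $ 2 $ 1 = c" "mk2 a b c d $ 2 $ 2 = d"
  by (simp_all add: mk2_def vector_def)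

lemma mk2_eq_iff [simp]: "mk2 a b c d = mk2 a' b' c' d' \<longleftrightarrow> a = a' \<and> b = b' \<and> c = c' \<and> d = d'"
  by (metis mk2_nth)

lemma mk2_surj: "A = mk2 (A $ 1 $ 1) (A $ 1 $ 2) (A $ 2 $ 1) (A $ 2 $ 2)"
  by (simp add: vec_eq_iff forall_2)

lemma mk2_cases: obtains a b c d where "A = mk2 a b c d"
  using mk2_surj by blast

lemma mk2_mult [simp]: "mk2 a b c d ** mk2 a' b' c' d' =
    mk2 (a * a' + b * c') (a * b' + b * d') (c * a' + d * c') (c * b' + d * d')"
  by (simp add: vec_eq_iff forall_2 matrix_matrix_mult_def sum_2)

lemma mk2_add [simp]: "mk2 a b c d + mk2 a' b' c' d' = mk2 (a + a') (b + b') (c + c') (d + d')"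
  and mk2_uminus [simp]: "- mk2 a b c d = mk2 (- a) (- b) (- c) (- d)"
  and mk2_scaleR [simp]: "k *\<^sub>R mk2 a b c d = mk2 (k * a) (k * b) (k * c) (k * d)"
  by (simp_all add: vec_eq_iff forall_2)

lemma mat_1_mk2: "(mat 1 :: real^2^2) = mk2 1 0 0 1"
  by (simp add: vec_eq_iff forall_2 mat_def)

lemma zero_mk2: "(0 :: real^2^2) = mk2 0 0 0 0"
  by (simp add: vec_eq_iff forall_2)

lemma T_mat_mk2: "T_mat = mk2 1 lam 0 1" and S_mat_mk2: "S_mat = mk2 0 1 (-1) 0"
  by (simp_all add: T_mat_def S_mat_def mk2_def)

lemma det_mk2 [simp]: "det (mk2 a b c d) = a * d - b * c"
  by (simp add: det_2)

text \<open>The adjugate is the inverse in determinant 1; being polynomial in the entries, it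
  computes under simplification.\<close>

definition adj2 :: "real^2^2 \<Rightarrow> real^2^2" where
  "adj2 A = mk2 (A $ 2 $ 2) (- A $ 1 $ 2) (- A $ 2 $ 1) (A $ 1 $ 1)"

lemma adj2_mk2 [simp]: "adj2 (mk2 a b c d) = mk2 d (- b) (- c) a"
  by (simp add: adj2_def)

lemma adj2_inverse: "det A = 1 \<Longrightarrow> A ** adj2 A = mat 1" "det A = 1 \<Longrightarrow> adj2 A ** A = mat 1"
  by (cases A rule: mk2_cases; simp add: mat_1_mk2 mult.commute)+

lemma adj2_mult: "adj2 (A ** B) = adj2 B ** adj2 A"
  by (cases A rule: mk2_cases; cases B rule: mk2_cases; simp add: algebra_simps)

lemma adj2_adj2 [simp]: "adj2 (adj2 A) = A"
  by (cases A rule: mk2_cases; simp)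

lemma adj2_1 [simp]: "adj2 (mat 1) = mat 1"
  by (simp add: mat_1_mk2)

lemma adj2_uminus: "adj2 (- A) = - adj2 A"
  by (cases A rule: mk2_cases; simp)

lemma matrix_uminus_mult: "(- A) ** B = - (A ** B)" "A ** (- B) = - (A ** B)" for A B :: "real^2^2"
  by (cases A rule: mk2_cases; cases B rule: mk2_cases; simp)+

definition M2Zlam :: "(real^2^2) set" where
  "M2Zlam = {A. \<forall>i j. A $ i $ j \<in> Zlam}"

lemma mk2_in_M2Zlam [simp]: "mk2 a b c d \<in> M2Zlam \<longleftrightarrow> a \<in> Zlam \<and> b \<in> Zlam \<and> c \<in> Zlam \<and> d \<in> Zlam"
  by (auto simp: M2Zlam_def forall_2)

lemma M2Zlam_1 [simp]: "mat 1 \<in> M2Zlam" and M2Zlam_0 [simp]: "0 \<in> M2Zlam"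
  by (simp_all add: mat_1_mk2 zero_mk2)

lemma M2Zlam_add [simp]: "A \<in> M2Zlam \<Longrightarrow> B \<in> M2Zlam \<Longrightarrow> A + B \<in> M2Zlam"
  and M2Zlam_uminus [simp]: "A \<in> M2Zlam \<Longrightarrow> - A \<in> M2Zlam"
  and M2Zlam_mult [simp]: "A \<in> M2Zlam \<Longrightarrow> B \<in> M2Zlam \<Longrightarrow> A ** B \<in> M2Zlam"
  and M2Zlam_scaleR [simp]: "r \<in> Zlam \<Longrightarrow> A \<in> M2Zlam \<Longrightarrow> r *\<^sub>R A \<in> M2Zlam"
  and M2Zlam_adj2 [simp]: "A \<in> M2Zlam \<Longrightarrow> adj2 A \<in> M2Zlam"
  by (cases A rule: mk2_cases; cases B rule: mk2_cases; simp)+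

lemma SL2_Zlam_simps [simp]:
  "carrier SL2_Zlam = {A \<in> M2Zlam. det A = 1}" "monoid.mult SL2_Zlam = (**)" "one SL2_Zlam = mat 1"
  by (auto simp: SL2_Zlam_def M2Zlam_def)

lemma det_adj2: "det (adj2 A) = det A"
  by (cases A rule: mk2_cases; simp)

lemma group_SL2_Zlam: "group SL2_Zlam"
proof (rule groupI, goal_cases)
  case (5 A)
  then show ?case by (intro bexI[of _ "adj2 A"]) (auto simp: adj2_inverse det_adj2)
qed (auto simp: det_mul matrix_mul_assoc)

lemma inv_SL2_Zlam: "A \<in> carrier SL2_Zlam \<Longrightarrow> inv\<^bsub>SL2_Zlam\<^esub> A = adj2 A"
  by (rule group.inv_equality[OF group_SL2_Zlam]) (auto simp: adj2_inverse det_adj2)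

section \<open>Computing and inducting in the Hecke group\<close>

abbreviation HH :: "(real^2^2) set" where "HH \<equiv> carrier H5"

lemma H5_simps [simp]: "monoid.mult H5 = (**)" "one H5 = mat 1"
  by (auto simp: H5_def subgroup_generated_def)

lemma group_H5: "group H5"
  unfolding H5_def by (intro group.group_subgroup_generated group_SL2_Zlam)

lemma HH_subset: "HH \<subseteq> carrier SL2_Zlam"
  unfolding H5_def by (intro group.carrier_subgroup_generated_subset group_SL2_Zlam)

lemma HH_M2Zlam: "A \<in> HH \<Longrightarrow> A \<in> M2Zlam" and HH_det: "A \<in> HH \<Longrightarrow> det A = 1"
  using HH_subset by auto

lemma HH_one [simp]: "mat 1 \<in> HH"
  using monoid.one_closed[OF group.is_monoid[OF group_H5]] by simp

lemma HH_mult [simp]: "A \<in> HH \<Longrightarrow> B \<in> HH \<Longrightarrow> A ** B \<in> HH"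
  using monoid.m_closed[OF group.is_monoid[OF group_H5]] by simp

lemma HH_inverse [simp]:
  "A \<in> HH \<Longrightarrow> A ** adj2 A = mat 1" "A \<in> HH \<Longrightarrow> adj2 A ** A = mat 1"
  using HH_det adj2_inverse by auto

lemma HH_inverse_assoc [simp]:
  "A \<in> HH \<Longrightarrow> B ** A ** adj2 A = B" "A \<in> HH \<Longrightarrow> B ** adj2 A ** A = B"
  by (simp_all only: matrix_mul_assoc[symmetric] HH_inverse matrix_mul_rid)

lemma inv_H5: "A \<in> HH \<Longrightarrow> inv\<^bsub>H5\<^esub> A = adj2 A"
  using HH_subset group.inv_subgroup_generated[OF group_SL2_Zlam, of A "{T_mat, S_mat}"] inv_SL2_Zlam[of A]
  by (auto simp: H5_def)

lemma HH_adj2 [simp]: "A \<in> HH \<Longrightarrow> adj2 A \<in> HH"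
  using group.inv_closed[OF group_H5, of A] inv_H5[of A] by simp

lemma gens_SL2_Zlam: "T_mat \<in> carrier SL2_Zlam" "S_mat \<in> carrier SL2_Zlam"
  by (simp_all add: T_mat_mk2 S_mat_mk2)

lemma T_in_HH [simp]: "T_mat \<in> HH" and S_in_HH [simp]: "S_mat \<in> HH"
  using gens_SL2_Zlam by (auto simp: H5_def carrier_subgroup_generated intro: generate.incl)

lemma S_sq: "S_mat ** S_mat = - mat 1"
  by (simp add: S_mat_mk2 mat_1_mk2)

lemma minus_one_HH [simp]: "- mat 1 \<in> HH"
  using HH_mult[OF S_in_HH S_in_HH] by (simp add: S_sq)

lemma HH_uminus [simp]: "A \<in> HH \<Longrightarrow> - A \<in> HH"
  using HH_mult[OF minus_one_HH, of A] by (simp add: matrix_uminus_mult)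

lemma mult_lam_lam: "lam * (lam * x) = lam * x + x"
  by (simp add: lam_sq distrib_right flip: mult.assoc)

text \<open>This is the relation (S T)^5 = I solved for the inverse of T.\<close>

lemma adj2_T: "adj2 T_mat = S_mat ** T_mat ** S_mat ** T_mat ** S_mat ** T_mat ** S_mat ** T_mat ** S_mat"
  by (simp add: S_mat_mk2 T_mat_mk2 lam_sq algebra_simps)

text \<open>The inverses of S and T are positive words, namely S^3 and \<open>adj2_T\<close>, so S
  and T generate the group as a monoid.\<close>

lemma HH_induct [consumes 1, case_names one S T]:
  assumes "A \<in> HH" and one: "P (mat 1)"
    and S: "\<And>A. A \<in> HH \<Longrightarrow> P A \<Longrightarrow> P (A ** S_mat)"
    and T: "\<And>A. A \<in> HH \<Longrightarrow> P A \<Longrightarrow> P (A ** T_mat)"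
  shows "P A"
proof -
  have *: "A \<in> generate SL2_Zlam {T_mat, S_mat}"
    using assms(1) gens_SL2_Zlam by (auto simp: H5_def carrier_subgroup_generated Int_absorb1)
  have "generate SL2_Zlam {T_mat, S_mat} \<subseteq> HH"
    using gens_SL2_Zlam by (auto simp: H5_def carrier_subgroup_generated Int_absorb1)
  \<comment> \<open>The claim is strengthened to all left factors B, so that the product rule of
    \<open>generate\<close> becomes a composition of two implications.\<close>
  with * have "\<forall>B \<in> HH. P B \<longrightarrow> P (B ** A)"
  proof (induction rule: generate.induct)
    case one
    show ?case by simp
  next
    case (incl h)
    then show ?case using S T by auto
  next
    case (inv h)
    show ?case
    proof (intro ballI impI)
      fix B assume B: "B \<in> HH" "P B"
      have S': "P (B ** adj2 S_mat)" if "B \<in> HH" "P B" for B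
      proof -
        have "adj2 S_mat = S_mat ** S_mat ** S_mat" by (simp add: S_mat_mk2)
        then show ?thesis using that S by (simp add: matrix_mul_assoc)
      qed
      have "P (B ** adj2 T_mat)"
        unfolding adj2_T using B S T by (simp add: matrix_mul_assoc)
      then show "P (B ** inv\<^bsub>SL2_Zlam\<^esub> h)"
        using inv S'[OF B] inv_SL2_Zlam gens_SL2_Zlam by fastforce
    qed
  next
    case (eng h1 h2)
    then have "h1 \<in> HH" by blast
    with eng show ?case by (auto simp: matrix_mul_assoc)
  qed
  then show ?thesis using one by force
qed

section \<open>Congruences and the normal closure of a power of \<open>T\<close>\<close>

lemma scaleR_matrix_mult: "(k *\<^sub>R A) ** B = k *\<^sub>R (A ** B)" "A ** (k *\<^sub>R B) = k *\<^sub>R (A ** B)"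
  for A B :: "real^2^2"
  by (cases A rule: mk2_cases; cases B rule: mk2_cases; simp add: algebra_simps)+

lemma matrix_mult_add_right: "(A + B) ** C = A ** C + B ** C" for A B C :: "real^2^2"
  by (cases A rule: mk2_cases; cases B rule: mk2_cases; cases C rule: mk2_cases; simp add: algebra_simps)

definition mcong :: "int \<Rightarrow> real^2^2 \<Rightarrow> real^2^2 \<Rightarrow> bool" where
  "mcong n A B \<longleftrightarrow> (\<exists>C \<in> M2Zlam. A = B + of_int n *\<^sub>R C)"

lemma mcong_refl [simp]: "mcong n A A"
  unfolding mcong_def by (intro bexI[of _ 0]) auto

lemma mcong_sym: "mcong n A B \<Longrightarrow> mcong n B A"
  unfolding mcong_def by (elim bexE, rule_tac x="- C" in bexI) auto

lemma mcong_trans [trans]: "mcong n A B \<Longrightarrow> mcong n B C \<Longrightarrow> mcong n A C"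
  unfolding mcong_def by (elim bexE, rule_tac x="Ca + Caa" in bexI) (auto simp: scaleR_add_right)

lemma mcong_dvd: "mcong n A B \<Longrightarrow> k dvd n \<Longrightarrow> mcong k A B"
proof -
  assume "mcong n A B" "k dvd n"
  then obtain C l where "C \<in> M2Zlam" "A = B + of_int n *\<^sub>R C" "n = k * l"
    unfolding mcong_def by blast
  then show ?thesis unfolding mcong_def by (intro bexI[of _ "of_int l *\<^sub>R C"]) auto
qed

text \<open>A A' - B B' = (A - B) A' + B (A' - B'), hence the integrality of A' and B.\<close>

lemma mcong_mult:
  assumes "mcong n A B" "mcong n A' B'" "A' \<in> M2Zlam" "B \<in> M2Zlam"
  shows "mcong n (A ** A') (B ** B')"
proof -
  obtain C C' where C: "C \<in> M2Zlam" "A = B + of_int n *\<^sub>R C" "C' \<in> M2Zlam" "A' = B' + of_int n *\<^sub>R C'"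
    using assms unfolding mcong_def by blast
  have "A ** A' = B ** A' + of_int n *\<^sub>R (C ** A')"
    unfolding C(2) by (simp add: matrix_mult_add_right scaleR_matrix_mult)
  also have "B ** A' = B ** B' + of_int n *\<^sub>R (B ** C')"
    unfolding C(4) by (simp add: matrix_add_ldistrib scaleR_matrix_mult)
  finally have "A ** A' = B ** B' + of_int n *\<^sub>R (B ** C' + C ** A')"
    by (simp add: scaleR_add_right)
  then show ?thesis unfolding mcong_def using C assms
    by (intro bexI[of _ "B ** C' + C ** A'"]) auto
qed

text \<open>With u n + v q = 1 the difference is u n (A - B) + v q (A - B), and both summands are
  divisible by t n q.\<close>

lemma mcong_coprime:
  assumes "mcong (t * n) A B" "mcong (t * q) A B" "coprime n q"
  shows "mcong (t * n * q) A B"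
proof -
  obtain C D where C: "C \<in> M2Zlam" "A = B + of_int (t * n) *\<^sub>R C" "D \<in> M2Zlam" "A = B + of_int (t * q) *\<^sub>R D"
    using assms unfolding mcong_def by blast
  obtain u v where uv: "u * n + v * q = 1"
    using assms(3) bezout_int[of n q] by (metis coprime_iff_gcd_eq_1)
  then have uv': "of_int u * of_int n + of_int v * of_int q = (1 :: real)"
    by (metis of_int_1 of_int_add of_int_mult)
  have "A - B = (of_int u * of_int n + of_int v * of_int q) *\<^sub>R (A - B)" by (simp add: uv')
  also have "\<dots> = (of_int u * of_int n) *\<^sub>R (A - B) + (of_int v * of_int q) *\<^sub>R (A - B)"
    by (rule scaleR_add_left)
  also have "(of_int u * of_int n) *\<^sub>R (A - B) = (of_int u * of_int n) *\<^sub>R (of_int (t * q) *\<^sub>R D)"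
    using C(4) by simp
  also have "(of_int v * of_int q) *\<^sub>R (A - B) = (of_int v * of_int q) *\<^sub>R (of_int (t * n) *\<^sub>R C)"
    using C(2) by simp
  finally have "A = B + of_int (t * n * q) *\<^sub>R (of_int u *\<^sub>R D + of_int v *\<^sub>R C)"
    by (simp add: algebra_simps)
  then show ?thesis unfolding mcong_def using C by (intro bexI[of _ "of_int u *\<^sub>R D + of_int v *\<^sub>R C"]) auto
qed

definition Hprin :: "int \<Rightarrow> (real^2^2) set" where
  "Hprin n = {A \<in> HH. mcong n A (mat 1)}"

lemma mcong_1_adj2:
  assumes "A \<in> HH" "B \<in> HH" "mcong n A B"
  shows "mcong n (A ** adj2 B) (mat 1)"
  using mcong_mult[OF assms(3) mcong_refl, of "adj2 B"] assms by (simp add: HH_M2Zlam)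

lemma Hprin_quotient:
  "A \<in> HH \<Longrightarrow> B \<in> HH \<Longrightarrow> mcong n A B \<Longrightarrow> A ** adj2 B \<in> Hprin n"
  unfolding Hprin_def by (simp add: mcong_1_adj2)

section \<open>Conjugates of powers of T and their normal closure\<close>

definition E_mat :: "int \<Rightarrow> real^2^2" where
  "E_mat k = mk2 1 (of_int k * lam) 0 1"

definition conj_E :: "real^2^2 \<Rightarrow> int \<Rightarrow> real^2^2" where
  "conj_E g k = g ** E_mat k ** adj2 g"

definition Xlog :: "real^2^2 \<Rightarrow> real^2^2" where
  "Xlog g = g ** mk2 0 lam 0 0 ** adj2 g"

lemma E_mat_add: "E_mat (j + k) = E_mat j ** E_mat k"
  by (simp add: E_mat_def algebra_simps)

lemma E_mat_0 [simp]: "E_mat 0 = mat 1"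
  by (simp add: E_mat_def mat_1_mk2)

lemma E_mat_1: "E_mat 1 = T_mat"
  by (simp add: E_mat_def T_mat_mk2)

lemma adj2_E_mat: "adj2 (E_mat k) = E_mat (- k)"
  by (simp add: E_mat_def)

lemma E_mat_of_nat_HH: "E_mat (int n) \<in> HH"
  by (induction n) (simp_all add: E_mat_add E_mat_1)

lemma E_mat_HH [simp]: "E_mat k \<in> HH"
  by (metis E_mat_of_nat_HH HH_adj2 adj2_E_mat int_cases2)

lemma conj_E_HH [simp]: "g \<in> HH \<Longrightarrow> conj_E g k \<in> HH"
  by (simp add: conj_E_def)

text \<open>The square of T - I vanishes, so a conjugate of a power of T is exactly affine in the
  exponent.\<close>

lemma conj_E_eq: "g \<in> HH \<Longrightarrow> conj_E g k = mat 1 + of_int k *\<^sub>R Xlog g"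
proof -
  assume g: "g \<in> HH"
  have "E_mat k = mat 1 + of_int k *\<^sub>R mk2 0 lam 0 0" by (simp add: E_mat_def mat_1_mk2)
  then show ?thesis unfolding conj_E_def Xlog_def using g
    by (simp add: matrix_add_ldistrib matrix_mult_add_right scaleR_matrix_mult del: mk2_scaleR)
qed

lemma Xlog_M2Zlam [simp]: "g \<in> HH \<Longrightarrow> Xlog g \<in> M2Zlam"
  by (simp add: Xlog_def HH_M2Zlam)

text \<open>Negative k supply the inverses, so these right-built words form the whole normal closure
  of the n-th power of T.\<close>

inductive_set Nclos :: "int \<Rightarrow> (real^2^2) set" for n where
  one: "mat 1 \<in> Nclos n"
| step: "A \<in> Nclos n \<Longrightarrow> g \<in> HH \<Longrightarrow> A ** conj_E g (n * k) \<in> Nclos n"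

lemma Nclos_HH: "A \<in> Nclos n \<Longrightarrow> A \<in> HH"
  by (induction rule: Nclos.induct) auto

lemma Nclos_conj_E: "g \<in> HH \<Longrightarrow> conj_E g (n * k) \<in> Nclos n"
  using Nclos.step[OF Nclos.one] by simp

lemma Nclos_mult: "B \<in> Nclos n \<Longrightarrow> A \<in> Nclos n \<Longrightarrow> A ** B \<in> Nclos n"
  by (induction rule: Nclos.induct) (auto simp: matrix_mul_assoc intro: Nclos.step)

lemma Nclos_dvd: "A \<in> Nclos n \<Longrightarrow> l dvd n \<Longrightarrow> A \<in> Nclos l"
  by (induction rule: Nclos.induct) (auto simp: mult.assoc elim!: dvdE intro: Nclos.intros)

lemma Nclos_mcong: "A \<in> Nclos n \<Longrightarrow> mcong n A (mat 1)"
proof (induction rule: Nclos.induct)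
  case (step A g k)
  have "mcong n (conj_E g (n * k)) (mat 1)"
    unfolding mcong_def by (intro bexI[of _ "of_int k *\<^sub>R Xlog g"]) (use step in \<open>auto simp: conj_E_eq\<close>)
  then show ?case using mcong_mult[OF step(3), of "conj_E g (n * k)" "mat 1"] step by (simp add: HH_M2Zlam)
qed simp

text \<open>All exponents of a word for A are multiplied by e; by \<open>conj_E_eq\<close> each
  factor changes by a multiple of n (e - 1). The result depends on the word chosen for A.\<close>

lemma Nclos_scale:
  assumes "A \<in> Nclos n"
  shows "\<exists>B \<in> Nclos (n * e). mcong (n * (e - 1)) B A"
  using assms
proof (induction rule: Nclos.induct)
  case one
  show ?case by (intro bexI[of _ "mat 1"]) (auto intro: Nclos.one)
next
  case (step A g k)
  then obtain B where B: "B \<in> Nclos (n * e)" "mcong (n * (e - 1)) B A" by blast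
  have "conj_E g (n * e * k) = conj_E g (n * k) + of_int (n * (e - 1)) *\<^sub>R (of_int k *\<^sub>R Xlog g)"
    using step by (simp add: conj_E_eq algebra_simps)
  then have "mcong (n * (e - 1)) (conj_E g (n * e * k)) (conj_E g (n * k))"
    unfolding mcong_def using step by (intro bexI[of _ "of_int k *\<^sub>R Xlog g"]) auto
  then have "mcong (n * (e - 1)) (B ** conj_E g (n * e * k)) (A ** conj_E g (n * k))"
    using B step by (intro mcong_mult) (auto simp: HH_M2Zlam Nclos_HH)
  then show ?case using Nclos.step[OF B(1) step(2)] by blast
qed

text \<open>Chinese remaindering is done on the exponents of \<open>T\<close>: for \<open>e \<equiv> 0 (mod n)\<close> and \<open>e \<equiv> 1 (mod q)\<close>,
  replacing \<open>T\<^sup>t\<close> by \<open>T\<^sup>t\<^sup>e\<close> in a word changes nothing modulo \<open>t q\<close> and makes it trivial modulo \<open>t n\<close>.\<close>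

lemma Hprin_coprime_step:
  assumes H: "Hprin t \<subseteq> Nclos t" and cop: "coprime n q" and A: "A \<in> Hprin (t * n)"
  shows "\<exists>B \<in> Nclos (t * n). A ** adj2 B \<in> Hprin (t * n * q)"
proof -
  obtain u v where uv: "u * n + v * q = 1"
    using cop bezout_int[of n q] by (metis coprime_iff_gcd_eq_1)
  define e where "e = u * n"
  have e1: "e - 1 = - v * q" using uv by (simp add: e_def algebra_simps)
  have AH: "A \<in> HH" "mcong (t * n) A (mat 1)" using A by (auto simp: Hprin_def)
  then have "A \<in> Nclos t" using H mcong_dvd[of "t * n" A "mat 1" t] by (auto simp: Hprin_def)
  then obtain B where B: "B \<in> Nclos (t * e)" "mcong (t * (e - 1)) B A" using Nclos_scale by blast
  have 1: "mcong (t * q) A B" using B(2) e1 by (auto intro: mcong_sym mcong_dvd)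
  have "t * n dvd t * e" by (simp add: e_def)
  with B have BN: "B \<in> Nclos (t * n)" using Nclos_dvd by blast
  then have 2: "mcong (t * n) A B" using AH Nclos_mcong mcong_sym mcong_trans by metis
  have "mcong (t * n * q) A B"
    using 2 1 cop by (rule mcong_coprime)
  then show ?thesis using Hprin_quotient AH BN Nclos_HH by blast
qed

section \<open>Level two, and one step of the congruence filtration\<close>

lemma conj_E_1: "conj_E (mat 1) k = E_mat k"
  by (simp add: conj_E_def)

lemma E_mat_Nclos: "n dvd k \<Longrightarrow> E_mat k \<in> Nclos n"
  using Nclos_conj_E[of "mat 1"] by (auto simp: conj_E_1 elim!: dvdE)

text \<open>Killing T in (S T)^5 = I leaves S^5 = I, and S^4 = I then gives S = I. The displayed
  word makes this explicit.\<close>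

lemma S_mat_Nclos: "S_mat \<in> Nclos 1"
proof -
  have "S_mat = E_mat (-1) ** conj_E S_mat (-1) ** E_mat (-1) ** conj_E S_mat (-1) ** E_mat (-1)"
    by (simp add: S_mat_mk2 E_mat_def conj_E_def lam_sq algebra_simps)
  moreover have "conj_E S_mat (-1) \<in> Nclos 1" using Nclos_conj_E[OF S_in_HH, of 1 "-1"] by simp
  ultimately show ?thesis using E_mat_Nclos[of 1 "-1"] Nclos_mult by (metis one_dvd)
qed

lemma HH_Nclos: "A \<in> HH \<Longrightarrow> A \<in> Nclos 1"
  by (induction rule: HH_induct)
    (auto intro!: Nclos_mult S_mat_Nclos E_mat_Nclos Nclos.one simp flip: E_mat_1)

primrec rot :: "nat \<Rightarrow> real^2^2" where
  "rot 0 = mat 1"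
| "rot (Suc i) = rot i ** (S_mat ** T_mat)"

lemma rot_HH [simp]: "rot i \<in> HH"
  by (induction i) simp_all

lemma rot_add: "rot (i + j) = rot i ** rot j"
  by (induction j) (simp_all add: matrix_mul_assoc)

lemma rot_1: "rot 1 = mk2 0 1 (-1) (- lam)"
  by (simp add: S_mat_mk2 T_mat_mk2 mat_1_mk2)

lemma rot_5: "rot 5 = mat 1"
  by (simp add: eval_nat_numeral S_mat_mk2 T_mat_mk2 mat_1_mk2 lam_sq algebra_simps)

lemma rot_mult_5: "rot (5 * i) = mat 1"
  by (induction i) (simp_all add: rot_add rot_5)

lemma rot_mod_5: "rot (i mod 5) = rot i"
  by (metis mod_mult_div_eq rot_add rot_mult_5 matrix_mul_rid)

text \<open>The product of the five conjugates telescopes to the fifth power of T^2 (S T)^(-1) = - T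
  S, and (T S)^5 = I.\<close>

lemma minus_one_Nclos_2: "- mat 1 \<in> Nclos 2"
proof -
  have r: "rot 2 = rot 1 ** rot 1" "rot 3 = rot 1 ** rot 1 ** rot 1" "rot 4 = rot 1 ** rot 1 ** rot 1 ** rot 1"
    by (simp_all add: eval_nat_numeral matrix_mul_assoc)
  have "- mat 1 = conj_E (rot 0) 2 ** conj_E (rot 4) 2 ** conj_E (rot 3) 2 ** conj_E (rot 2) 2 ** conj_E (rot 1) 2"
    unfolding r rot_1 by (simp add: conj_E_def E_mat_def mat_1_mk2 lam_sq mult_lam_lam algebra_simps)
  moreover have "conj_E (rot i) 2 \<in> Nclos 2" for i using Nclos_conj_E[of "rot i" 2 1] by simp
  ultimately show ?thesis using Nclos_mult by metis
qed

lemma Nclos_2_uminus: "A \<in> Nclos 2 \<Longrightarrow> - A \<in> Nclos 2"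
  using Nclos_mult[OF minus_one_Nclos_2, of A] by (simp add: matrix_uminus_mult)

text \<open>Modulo the normal closure of \<open>T\<^sup>2\<close> the group becomes dihedral of order 10, with rotation \<open>S T\<close>
  and reflection \<open>S\<close>.\<close>

lemma HH_dihedral: "A \<in> HH \<Longrightarrow> \<exists>C \<in> Nclos 2. \<exists>i. A = C ** rot i \<or> A = C ** rot i ** S_mat"
proof (induction rule: HH_induct)
  case one
  show ?case by (intro bexI[of _ "mat 1"] exI[of _ 0]) (auto intro: Nclos.one)
next
  case (S A)
  then obtain C i where C: "C \<in> Nclos 2" "A = C ** rot i \<or> A = C ** rot i ** S_mat" by blast
  have "C ** rot i ** S_mat ** S_mat = (- C) ** rot i"
    by (metis S_sq matrix_mul_assoc matrix_uminus_mult matrix_mul_rid)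
  then show ?case using C Nclos_2_uminus by metis
next
  case (T A)
  then obtain C i where C: "C \<in> Nclos 2" "A = C ** rot i \<or> A = C ** rot i ** S_mat" by blast
  have 1: "C ** rot i ** S_mat ** T_mat = C ** rot (Suc i)" by (simp add: matrix_mul_assoc)
  \<comment> \<open>As (S T)^4 is the inverse of S T, one has T = T^2 (S T)^4 S; the factor T^2 is
    then moved left as a conjugate.\<close>
  have "rot 4 = rot 1 ** rot 1 ** rot 1 ** rot 1" by (simp add: eval_nat_numeral matrix_mul_assoc)
  then have "rot 4 ** S_mat = E_mat (-1)"
    unfolding rot_1 by (simp add: S_mat_mk2 E_mat_def lam_sq mult_lam_lam algebra_simps)
  then have "E_mat 2 ** (rot 4 ** S_mat) = T_mat"
    by (simp flip: E_mat_add add: E_mat_1)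
  then have "C ** rot i ** T_mat = C ** rot i ** E_mat 2 ** rot 4 ** S_mat"
    by (metis matrix_mul_assoc)
  also have "\<dots> = (C ** conj_E (rot i) (2 * 1)) ** rot (i + 4) ** S_mat"
    by (simp add: conj_E_def rot_add matrix_mul_assoc)
  finally have "C ** rot i ** T_mat = \<dots>" .
  then show ?case using C 1 Nclos.step[OF C(1) rot_HH, of i 1] by metis
qed

lemma rot_mcong_2:
  assumes "mcong 2 (rot i) (mat 1)"
  shows "i mod 5 = 0"
proof (rule ccontr)
  assume "i mod 5 \<noteq> 0"
  have *: "mcong 2 (rot (i * k)) (mat 1)" for k
  proof (induction k)
    case (Suc k)
    then have "mcong 2 (rot i ** rot (i * k)) (mat 1 ** mat 1)"
      using assms by (intro mcong_mult) (auto simp: HH_M2Zlam)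
    then show ?case by (simp add: rot_add)
  qed simp
  have "i mod 5 = 1 \<or> i mod 5 = 2 \<or> i mod 5 = 3 \<or> i mod 5 = 4"
    using \<open>i mod 5 \<noteq> 0\<close> by presburger
  \<comment> \<open>Here k is an inverse of i modulo 5, so that S T itself would be trivial modulo
    2.\<close>
  then obtain k where "(i mod 5) * k mod 5 = 1"
    by (elim disjE) (auto intro: that[of 1] that[of 3] that[of 2] that[of 4])
  then have "i * k mod 5 = 1" by (simp add: mod_mult_left_eq)
  with *[of k] have "mcong 2 (rot 1) (mat 1)" using rot_mod_5[of "i * k"] by simp
  then obtain C where "C \<in> M2Zlam" "rot 1 = mat 1 + of_int 2 *\<^sub>R C"
    unfolding mcong_def by blast
  then show False
    using one_not_double_Zlam unfolding rot_1 mat_1_mk2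
    by (cases C rule: mk2_cases) auto
qed

lemma S_not_mcong_2: "\<not> mcong 2 S_mat (mat 1)"
  using one_not_double_Zlam unfolding S_mat_mk2 mat_1_mk2 mcong_def
  by (auto, case_tac C rule: mk2_cases) auto

text \<open>The dihedral quotient stays faithful modulo 2. Rotations are handled by
  \<open>rot_mcong_2\<close>. A trivial reflection would make a rotation congruent to the inverse of
  S, whose square is - I; so that rotation is trivial and S would be congruent to I.\<close>

lemma Hprin_2: "Hprin 2 \<subseteq> Nclos 2"
proof
  fix A assume "A \<in> Hprin 2"
  then have A: "A \<in> HH" "mcong 2 A (mat 1)" by (auto simp: Hprin_def)
  then obtain C i where C: "C \<in> Nclos 2" "A = C ** rot i \<or> A = C ** rot i ** S_mat"
    using HH_dihedral by blast
  have reduce: "mcong 2 B (mat 1)" if "A = C ** B" "B \<in> HH" for B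
    using mcong_mult[OF Nclos_mcong[OF C(1)] mcong_refl, of B] that A HH_M2Zlam
      mcong_sym mcong_trans by (metis M2Zlam_1 matrix_mul_lid)
  from C(2) show "A \<in> Nclos 2"
  proof
    assume "A = C ** rot i"
    then have "i mod 5 = 0" using reduce rot_mcong_2 by simp
    then have "rot i = mat 1" using rot_mod_5[of i] by simp
    then show ?thesis using \<open>A = C ** rot i\<close> C by simp
  next
    assume AS: "A = C ** rot i ** S_mat"
    then have "A = C ** (rot i ** S_mat)" by (simp add: matrix_mul_assoc)
    then have *: "mcong 2 (rot i ** S_mat) (mat 1)" using reduce by simp
    have "mcong 2 (rot i ** S_mat ** adj2 S_mat) (mat 1 ** adj2 S_mat)"
      by (intro mcong_mult * mcong_refl) (auto simp: HH_M2Zlam)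
    then have r: "mcong 2 (rot i) (adj2 S_mat)" by simp
    then have "mcong 2 (rot i ** rot i) (adj2 S_mat ** adj2 S_mat)"
      by (intro mcong_mult) (auto simp: HH_M2Zlam)
    moreover have "mcong 2 (adj2 S_mat ** adj2 S_mat) (mat 1)"
      unfolding mcong_def by (intro bexI[of _ "- mat 1"]) (simp_all add: S_mat_mk2 mat_1_mk2)
    ultimately have "mcong 2 (rot (i + i)) (mat 1)" unfolding rot_add by (rule mcong_trans)
    then have "(i + i) mod 5 = 0" by (rule rot_mcong_2)
    then have "i mod 5 = 0" by presburger
    then have "rot i = mat 1" using rot_mod_5[of i] by simp
    then show ?thesis using * S_not_mcong_2 by simp
  qed
qed

section \<open>The lattice of conjugates of T - I\<close>

inductive_set Llat :: "(real^2^2) set" where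
  zero: "0 \<in> Llat"
| step: "X \<in> Llat \<Longrightarrow> g \<in> HH \<Longrightarrow> X + of_int k *\<^sub>R Xlog g \<in> Llat"

lemma Llat_Xlog: "g \<in> HH \<Longrightarrow> Xlog g \<in> Llat"
  using Llat.step[OF Llat.zero, of g 1] by simp

lemma Llat_add: "Y \<in> Llat \<Longrightarrow> X \<in> Llat \<Longrightarrow> X + Y \<in> Llat"
  by (induction rule: Llat.induct) (auto simp flip: add.assoc intro: Llat.step)

lemma Llat_scale: "X \<in> Llat \<Longrightarrow> of_int k *\<^sub>R X \<in> Llat"
proof (induction rule: Llat.induct)
  case (step X g j)
  then show ?case using Llat.step[of "of_int k *\<^sub>R X" g "k * j"] by (simp add: scaleR_add_right)
qed (simp add: Llat.zero)

lemma Llat_M2Zlam: "X \<in> Llat \<Longrightarrow> X \<in> M2Zlam"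
  by (induction rule: Llat.induct) auto

text \<open>Multiplying factors I + n k X adds the terms k X, up to cross terms divisible by
  n^2.\<close>

lemma Llat_Nclos: "X \<in> Llat \<Longrightarrow> \<exists>B \<in> Nclos n. mcong (n * n) B (mat 1 + of_int n *\<^sub>R X)"
proof (induction rule: Llat.induct)
  case zero
  show ?case by (intro bexI[of _ "mat 1"]) (auto intro: Nclos.one)
next
  case (step X g k)
  then obtain B where B: "B \<in> Nclos n" "mcong (n * n) B (mat 1 + of_int n *\<^sub>R X)" by blast
  have "mcong (n * n) (B ** conj_E g (n * k)) ((mat 1 + of_int n *\<^sub>R X) ** conj_E g (n * k))"
    using B step Llat_M2Zlam by (intro mcong_mult) (auto simp: HH_M2Zlam)
  moreover have "mcong (n * n) ((mat 1 + of_int n *\<^sub>R X) ** conj_E g (n * k))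
      (mat 1 + of_int n *\<^sub>R (X + of_int k *\<^sub>R Xlog g))"
    unfolding mcong_def using step Llat_M2Zlam[OF step(1)]
    by (intro bexI[of _ "of_int k *\<^sub>R (X ** Xlog g)"])
      (auto simp: conj_E_eq matrix_add_ldistrib matrix_mult_add_right scaleR_matrix_mult algebra_simps)
  ultimately show ?case using Nclos.step[OF B(1) step(2)] mcong_trans by blast
qed

text \<open>This is \<open>lam\<close> times the column (a, c) times the row (- c, a), a quadratic
  function of the first column.\<close>

lemma Xlog_mk2: "Xlog (mk2 a b c d) = mk2 (- (lam * a * c)) (lam * a * a) (- (lam * c * c)) (lam * a * c)"
  by (simp add: Xlog_def)

text \<open>The conjugates of \<open>T\<close> by elements with first column \<open>(1,0)\<close>, \<open>(0,1)\<close>, \<open>(\<lambda>,1)\<close>, \<open>(1,\<lambda>)\<close>,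
  \<open>(\<lambda>,\<lambda>)\<close>, \<open>(2\<lambda>,1)\<close>, \<open>(1,2\<lambda>)\<close> (up to sign) suffice.\<close>

lemma Llat_double_trace_zero:
  assumes "x \<in> Zlam" "y \<in> Zlam" "z \<in> Zlam"
  shows "2 *\<^sub>R mk2 x y z (- x) \<in> Llat"
proof -
  note comp = S_mat_mk2 E_mat_def mat_1_mk2 Xlog_mk2 lam_sq mult_lam_lam algebra_simps
  have eq_mem: "B \<in> Llat" if "A \<in> Llat" "A = B" for A B using that by simp
  have X1: "mk2 0 lam 0 0 \<in> Llat"
    by (rule eq_mem[OF Llat_Xlog[OF HH_one]]) (simp add: comp)
  have X2: "mk2 0 0 (- lam) 0 \<in> Llat"
    by (rule eq_mem[OF Llat_Xlog[OF S_in_HH]]) (simp add: comp)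
  have X3: "mk2 (- lam - 1) (2 * lam + 1) (- lam) (lam + 1) \<in> Llat"
    by (rule eq_mem[OF Llat_Xlog[OF HH_mult[OF E_mat_HH[of 1] S_in_HH]]]) (simp add: comp)
  have X4: "mk2 (- lam - 1) lam (- 1 - 2 * lam) (lam + 1) \<in> Llat"
    by (rule eq_mem[OF Llat_Xlog[OF HH_mult[OF HH_mult[OF S_in_HH E_mat_HH[of "-1"]] S_in_HH]]]) (simp add: comp)
  have X5: "mk2 (- 2 * lam - 1) (2 * lam + 1) (- 2 * lam - 1) (2 * lam + 1) \<in> Llat"
    by (rule eq_mem[OF Llat_Xlog[OF HH_mult[OF HH_mult[OF E_mat_HH[of 1] S_in_HH] HH_mult[OF E_mat_HH[of 1]
      S_in_HH]]]]) (simp add: comp)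
  have X6: "mk2 (- 2 * lam - 2) (8 * lam + 4) (- lam) (2 * lam + 2) \<in> Llat"
    by (rule eq_mem[OF Llat_Xlog[OF HH_mult[OF E_mat_HH[of 2] S_in_HH]]]) (simp add: comp)
  have X7: "mk2 (- 2 * lam - 2) lam (- 8 * lam - 4) (2 * lam + 2) \<in> Llat"
    by (rule eq_mem[OF Llat_Xlog[OF HH_mult[OF HH_mult[OF S_in_HH E_mat_HH[of "-2"]] S_in_HH]]]) (simp add: comp)
  note LS = Llat_add Llat_scale
  \<comment> \<open>The second difference of the matrices for columns (t \<open>lam\<close>, 1), t =
    0, 1, 2, has the single entry 2 \<open>lam\<close>^3 = 4 \<open>lam\<close> + 2; four times
    \<open>X1\<close> is then removed. \<open>F\<close> is the transposed computation.\<close>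
  have E: "mk2 0 2 0 0 \<in> Llat"
    by (rule eq_mem[OF LS(1)[OF LS(1)[OF LS(1)[OF LS(2)[OF X1, of "-4"] X2] LS(2)[OF X3, of "-2"]] X6] ]) (simp add:
      algebra_simps)
  have F: "mk2 0 0 2 0 \<in> Llat"
    by (rule eq_mem[OF LS(2)[OF LS(1)[OF LS(1)[OF LS(1)[OF LS(2)[OF X2, of "-4"] X1] LS(2)[OF X4, of "-2"]] X7], of
      "-1"]
    ]) (simp add: algebra_simps)
  \<comment> \<open>Clearing the off-diagonal entries of -2 \<open>X3\<close> and -2
    \<open>X5\<close> leaves 2 \<open>lam\<close>^2 and 2 \<open>lam\<close>^3 on the diagonal;
    these combine to 2 and 2 \<open>lam\<close>.\<close>
  have H1: "mk2 (2 * lam + 2) 0 0 (- 2 * lam - 2) \<in> Llat"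
    by (rule eq_mem[OF LS(1)[OF LS(1)[OF LS(1)[OF LS(2)[OF X1, of "4"] LS(2)[OF X2, of 2]] LS(2)[OF X3, of "-2"]] E]
    ]) (simp add: algebra_simps)
  have H2: "mk2 (4 * lam + 2) 0 0 (- 4 * lam - 2) \<in> Llat"
    by (rule eq_mem[OF LS(1)[OF LS(1)[OF LS(1)[OF LS(1)[OF LS(2)[OF X1, of "4"] LS(2)[OF X2, of 4]] LS(2)[OF X5, of
      "-2"]]
      LS(2)[OF E, of 1]] LS(2)[OF F, of "-1"]]]) (simp add: algebra_simps)
  have H: "mk2 2 0 0 (- 2) \<in> Llat"
    by (rule eq_mem[OF LS(1)[OF LS(2)[OF H1, of 2] LS(2)[OF H2, of "-1"]] ]) (simp add: algebra_simps)
  have Hl: "mk2 (2 * lam) 0 0 (- 2 * lam) \<in> Llat"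
    by (rule eq_mem[OF LS(1)[OF H1 LS(2)[OF H, of "-1"]] ]) (simp add: algebra_simps)
  obtain a b c d e f :: int where xyz:
    "x = of_int a + of_int b * lam" "y = of_int c + of_int d * lam" "z = of_int e + of_int f * lam"
    using assms unfolding Zlam_iff by blast
  show ?thesis
    by (rule eq_mem[OF LS(1)[OF LS(1)[OF LS(1)[OF LS(2)[OF H, of a] LS(2)[OF Hl, of b]]
          LS(1)[OF LS(2)[OF E, of c] LS(2)[OF X1, of "2 * d"]]]
          LS(1)[OF LS(2)[OF F, of e] LS(2)[OF X2, of "- 2 * f"]]]]) (simp add: xyz algebra_simps)
qed

text \<open>Write A = I + r n C. Determinant 1 gives C = X + r n D with X of trace zero, and an even
  s puts s X into the lattice. The three divisibilities by d absorb, in order, the n^2 error of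
  \<open>Llat_Nclos\<close>, the exchange of r for s, and the term with D.\<close>

lemma Hprin_layer:
  assumes A: "A \<in> Hprin (r * n)" and "n \<noteq> 0" "r \<noteq> 0" and d: "d dvd n" "d dvd r - s" "d dvd r * r * n" and "even s"
  shows "\<exists>B \<in> Nclos n. A ** adj2 B \<in> Hprin (n * d)"
proof -
  obtain C where C: "C \<in> M2Zlam" "A = mat 1 + of_int (r * n) *\<^sub>R C" and AH: "A \<in> HH"
    using A by (auto simp: Hprin_def mcong_def)
  obtain x y z w where Cm: "C = mk2 x y z w" by (rule mk2_cases)
  have Z: "x \<in> Zlam" "y \<in> Zlam" "z \<in> Zlam" "w \<in> Zlam" using C Cm by auto
  define q :: real where "q = of_int (r * n)"
  have "q \<noteq> 0" using assms by (simp add: q_def)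
  have "(1 + q * x) * (1 + q * w) - q * y * (q * z) = 1"
    using HH_det[OF AH] C(2) Cm by (simp add: q_def mat_1_mk2)
  then have "q * (x + w + q * (x * w - y * z)) = 0" by (simp add: algebra_simps)
  \<comment> \<open>The determinant condition determines the trace of C.\<close>
  then have w: "w = - x - q * (x * w - y * z)" using \<open>q \<noteq> 0\<close> by simp
  define X where "X = mk2 x y z (- x)"
  define D where "D = mk2 0 0 0 (- (x * w - y * z))"
  have D: "D \<in> M2Zlam" and X: "X \<in> M2Zlam" using Z by (simp_all add: D_def X_def)
  have CX: "C = X + q *\<^sub>R D" using w by (simp add: Cm X_def D_def algebra_simps)
  obtain t where t: "s = 2 * t" using \<open>even s\<close> by blast
  have "of_int s *\<^sub>R X \<in> Llat"
    using Llat_scale[OF Llat_double_trace_zero[OF Z(1-3)], of t] by (simp add: t X_def algebra_simps)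
  then obtain B where B: "B \<in> Nclos n" "mcong (n * n) B (mat 1 + of_int n *\<^sub>R (of_int s *\<^sub>R X))"
    using Llat_Nclos by blast
  have 1: "mcong (n * d) B (mat 1 + of_int n *\<^sub>R (of_int s *\<^sub>R X))"
    using B(2) by (rule mcong_dvd) (use d in auto)
  obtain k l where k: "r - s = d * k" and l: "r * r * n = d * l" using d by blast
  have "A = mat 1 + of_int n *\<^sub>R (of_int s *\<^sub>R X) + (of_int n * of_int (r - s)) *\<^sub>R X
      + (of_int n * of_int (r * r * n)) *\<^sub>R D"
    unfolding C(2) CX q_def by (simp add: algebra_simps)
  also have "\<dots> = mat 1 + of_int n *\<^sub>R (of_int s *\<^sub>R X) + of_int (n * d) *\<^sub>R (of_int k *\<^sub>R X + of_int l *\<^sub>R D)"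
    unfolding k l by (simp add: algebra_simps)
  finally have "mcong (n * d) A (mat 1 + of_int n *\<^sub>R (of_int s *\<^sub>R X))"
    unfolding mcong_def using D X by (intro bexI[of _ "of_int k *\<^sub>R X + of_int l *\<^sub>R D"]) auto
  then have "mcong (n * d) A B" using 1 mcong_sym mcong_trans by blast
  then show ?thesis using AH B Nclos_HH Hprin_quotient by blast
qed

section \<open>Coverings between principal congruence subgroups\<close>

text \<open>That is, H(r) \<subseteq> H(M) N(n): what passes from H(M) and N(n) to a subgroup
  containing both.\<close>

definition covers :: "int \<Rightarrow> int \<Rightarrow> int \<Rightarrow> bool" where
  "covers r n M \<longleftrightarrow> (\<forall>A \<in> Hprin r. \<exists>B \<in> Nclos n. A ** adj2 B \<in> Hprin M)"

lemma covers_trans: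
  assumes "covers r n M" "covers M n' M'" "n dvd n'"
  shows "covers r n M'"
  unfolding covers_def
proof
  fix A assume "A \<in> Hprin r"
  then obtain B where B: "B \<in> Nclos n" "A ** adj2 B \<in> Hprin M" using assms(1) unfolding covers_def by blast
  then obtain B' where B': "B' \<in> Nclos n'" "A ** adj2 B ** adj2 B' \<in> Hprin M'"
    using assms(2) unfolding covers_def by blast
  have "B' ** B \<in> Nclos n" using Nclos_mult[OF B(1)] Nclos_dvd[OF B'(1) assms(3)] by blast
  moreover have "A ** adj2 (B' ** B) \<in> Hprin M'"
    using B'(2) by (simp add: adj2_mult matrix_mul_assoc)
  ultimately show "\<exists>B \<in> Nclos n. A ** adj2 B \<in> Hprin M'" by blast
qed

lemma covers_refl: "covers n n n"
  unfolding covers_def by (auto intro!: bexI[of _ "mat 1"] Nclos.one)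

text \<open>For odd q the number s = q + 1 is even and congruent to 1 modulo q.\<close>

lemma covers_odd_divisor: "odd q \<Longrightarrow> q dvd n \<Longrightarrow> n \<noteq> 0 \<Longrightarrow> covers n n (n * q)"
  unfolding covers_def using Hprin_layer[of _ 1 n q "q + 1"] by auto

text \<open>Starting from level 2 n the even factor r = s = 2 is already present. This is the origin
  of 2 m in the second case.\<close>

lemma covers_double: "4 dvd n \<Longrightarrow> n \<noteq> 0 \<Longrightarrow> covers (2 * n) n (2 * n * 2)"
  unfolding covers_def using Hprin_layer[of _ 2 n 4 2] by (auto simp: mult.commute)

lemma covers_coprime: "coprime n q \<Longrightarrow> covers n n (n * q)"
  unfolding covers_def using Hprin_coprime_step[of 1 n q] HH_Nclos by (auto simp: Hprin_def)

lemma covers_twice_odd: "odd n \<Longrightarrow> covers (2 * n) (2 * n) (2 * n * 2 ^ k)"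
  unfolding covers_def using Hprin_coprime_step[OF Hprin_2, of n "2 ^ k"] by auto

text \<open>Primes are adjoined one at a time: by the lattice if p divides the current level, by
  rescaled exponents otherwise.\<close>

lemma covers_odd: "odd M \<Longrightarrow> n \<noteq> 0 \<Longrightarrow> covers n n (n * int M)"
proof (induction M arbitrary: n rule: prime_divisors_induct)
  case (factor p M)
  then have odd: "odd p" "odd M" and "prime p" by auto
  have "covers n n (n * int p)"
  proof (cases "int p dvd n")
    case True
    then show ?thesis using odd factor.prems covers_odd_divisor by simp
  next
    case False
    then have "coprime n (int p)"
      using \<open>prime p\<close> by (metis coprime_commute prime_imp_coprime prime_nat_int_transfer)
    then show ?thesis by (rule covers_coprime)
  qed
  moreover have "covers (n * int p) (n * int p) (n * int p * int M)"
    using factor.IH odd factor.prems \<open>prime p\<close> prime_gt_0_nat by auto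
  ultimately show ?case by (auto dest: covers_trans simp: mult.assoc)
qed (auto intro: covers_refl)

lemma covers_double_power: "4 dvd n \<Longrightarrow> n \<noteq> 0 \<Longrightarrow> covers (2 * n) n (2 * n * 2 ^ k)"
proof (induction k)
  case 0
  show ?case unfolding covers_def
    by (auto intro!: bexI[of _ "mat 1"] Nclos.one)
next
  case (Suc k)
  \<comment> \<open>The doubling step is taken at the deeper level n 2^k, whose normal closure lies
    in that of level n.\<close>
  have "covers (2 * (n * 2 ^ k)) (n * 2 ^ k) (2 * (n * 2 ^ k) * 2)"
    using Suc by (intro covers_double) auto
  then show ?case using covers_trans[OF Suc.IH] Suc.prems by (simp add: mult_ac)
qed

lemma nat_2_power_odd:
  assumes "(M :: nat) > 0"
  obtains k N where "M = 2 ^ k * N" "odd N"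
proof -
  obtain N where "M = 2 ^ multiplicity 2 M * N" "odd N"
    by (rule multiplicity_decompose'[of M 2]) (use assms in auto)
  then show thesis by (rule that)
qed

text \<open>The power of 2 comes first, by coprimality for odd m and through \<open>Hprin_2\<close>
  for m twice odd; the odd part of M follows.\<close>

lemma covers_not_4_dvd:
  assumes "m > 0" "M > 0" "\<not> 4 dvd m"
  shows "covers (int m) (int m) (int (m * M))"
proof -
  obtain k N where M: "M = 2 ^ k * N" "odd N" using nat_2_power_odd assms by blast
  have "covers (int m) (int m) (int m * 2 ^ k)"
  proof (cases "odd m")
    case True
    then show ?thesis by (intro covers_coprime) auto
  next
    case False
    then obtain n where n: "m = 2 * n" by blast
    then have "odd n" using assms(3) by auto
    then show ?thesis using covers_twice_odd[of "int n" k] n by simp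
  qed
  moreover have "covers (int m * 2 ^ k) (int m * 2 ^ k) (int m * 2 ^ k * int N)"
    using M assms by (intro covers_odd) auto
  ultimately have "covers (int m) (int m) (int m * 2 ^ k * int N)" by (rule covers_trans) simp
  then show ?thesis by (simp add: M mult.assoc)
qed

lemma covers_4_dvd:
  assumes "m > 0" "M > 0" "4 dvd m"
  shows "covers (int (2 * m)) (int m) (int (2 * m * M))"
proof -
  obtain k N where M: "M = 2 ^ k * N" "odd N" using nat_2_power_odd assms by blast
  have "4 dvd int m" using assms(3) by presburger
  then have "covers (2 * int m) (int m) (2 * int m * 2 ^ k)"
    using assms by (intro covers_double_power) auto
  moreover have "covers (2 * int m * 2 ^ k) (2 * int m * 2 ^ k) (2 * int m * 2 ^ k * int N)"
    using M assms by (intro covers_odd) auto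
  ultimately have "covers (2 * int m) (int m) (2 * int m * 2 ^ k * int N)" by (rule covers_trans) simp
  then show ?thesis by (simp add: M mult.assoc)
qed

section \<open>Entries of elements of \<open>H\<^sub>5\<close> and the stabiliser of infinity\<close>

inductive_set pos_words :: "(real^2^2) set" where
  one: "mat 1 \<in> pos_words"
| step: "v \<in> pos_words \<Longrightarrow>
    w \<in> {mk2 1 lam 0 1, mk2 lam lam 1 lam, mk2 lam 1 lam lam, mk2 1 0 lam 1} \<Longrightarrow> v ** w \<in> pos_words"

text \<open>The set consisting of 0 and the reals from 1 on is closed under sums and products, and
  contains 0, 1 and \<open>lam\<close>.\<close>

lemma pos_words_entries:
  "v \<in> pos_words \<Longrightarrow> v $ i $ j = 0 \<or> v $ i $ j \<ge> 1"
proof (induction arbitrary: i j rule: pos_words.induct)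
  case one
  show ?case by (simp add: mat_def)
next
  case (step v w)
  have mult: "x * y = 0 \<or> x * y \<ge> 1" if "x = 0 \<or> x \<ge> 1" "y = 0 \<or> y \<ge> 1" for x y :: real
    using that mult_mono[of 1 x 1 y] by auto
  have add: "x + y = 0 \<or> x + y \<ge> 1" if "x = 0 \<or> x \<ge> 1" "y = 0 \<or> y \<ge> 1" for x y :: real
    using that by auto
  have "w $ 1 $ j = 0 \<or> w $ 1 $ j \<ge> 1" "w $ 2 $ j = 0 \<or> w $ 2 $ j \<ge> 1"
    using step(2) lam_gt_1 exhaust_2[of j] by auto
  then show ?case using add[OF mult[OF step(3) ] mult[OF step(3)]] by (simp add: matrix_matrix_mult_def sum_2)
qed

text \<open>\<open>H\<^sub>5\<close> is the free product of \<open>\<langle>S\<rangle>\<close> and \<open>\<langle>S T\<rangle>\<close> amalgamated along the centre; the generators of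
  \<open>pos_words\<close> are \<open>\<plusminus>S (S T)\<^sup>i\<close> for \<open>1 \<le> i \<le> 4\<close>, so this is the normal form of free products.\<close>

lemma HH_normal_form:
  "A \<in> HH \<Longrightarrow> \<exists>v \<in> pos_words. \<exists>s \<in> {mat 1, S_mat}. \<exists>s' \<in> {mat 1, S_mat}. A = s ** v ** s' \<or> A = - (s ** v ** s')"
proof (induction rule: HH_induct)
  case one
  show ?case using pos_words.one by force
next
  case (S A)
  then obtain v s s' where *: "v \<in> pos_words" "s \<in> {mat 1, S_mat}" "s' \<in> {mat 1, S_mat}"
    "A = s ** v ** s' \<or> A = - (s ** v ** s')" by blast
  have "s ** v ** S_mat ** S_mat = - (s ** v ** mat 1)"
    by (simp add: S_sq matrix_uminus_mult flip: matrix_mul_assoc)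
  then show ?case using * by (auto simp: matrix_uminus_mult)
next
  case (T A)
  then obtain v s s' where *: "v \<in> pos_words" "s \<in> {mat 1, S_mat}" "s' \<in> {mat 1, S_mat}"
    "A = s ** v ** s' \<or> A = - (s ** v ** s')" by blast
  let ?P = "\<lambda>A. \<exists>v \<in> pos_words. \<exists>s \<in> {mat 1, S_mat}. \<exists>s' \<in> {mat 1, S_mat}. A = s ** v ** s' \<or> A = - (s ** v ** s')"
  have neg: "?P A \<Longrightarrow> ?P (- A)" for A by (metis minus_minus)
  have posT: "?P (s ** (v ** T_mat))" if "v \<in> pos_words" for v
    using pos_words.step[OF that, of T_mat] *(2) by (metis T_mat_mk2 insertI1 matrix_mul_rid)
  have "?P (s ** v ** s' ** T_mat)"
  proof (cases "s' = mat 1")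
    case True
    then show ?thesis using posT[OF *(1)] by (simp add: matrix_mul_assoc)
  next
    case False
    then have s': "s' = S_mat" using * by blast
    show ?thesis using *(1)
    proof (cases rule: pos_words.cases)
      case one
      have T: "T_mat \<in> pos_words" using pos_words.step[OF pos_words.one, of T_mat] by (simp add: T_mat_mk2)
      from *(2) consider "s = mat 1" | "s = S_mat" by blast
      then show ?thesis
      proof cases
        case 1
        then have "s ** v ** s' ** T_mat = S_mat ** T_mat ** mat 1" using one s' by simp
        then show ?thesis using T by blast
      next
        case 2
        then have "s ** v ** s' ** T_mat = - (mat 1 ** T_mat ** mat 1)" using one s'
          by (simp add: S_sq matrix_uminus_mult)
        then show ?thesis using T by blast
      qed
    next
      case (step u w)
      have u: "s ** v ** s' ** T_mat = s ** (u ** (w ** S_mat ** T_mat))"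
        unfolding step s' by (simp add: matrix_mul_assoc)
      define U where "U = {mk2 1 lam 0 1, mk2 lam lam 1 lam, mk2 lam 1 lam lam, mk2 1 0 lam 1}"
      \<comment> \<open>Up to sign this turns S (S T)^i into S (S T)^(i+1); at i = 4 the block
        collapses to S, since (S T)^5 = I.\<close>
      have "w ** S_mat ** T_mat = S_mat \<or> (\<exists>w' \<in> U. w ** S_mat ** T_mat = - w')"
        using step(3) unfolding U_def by (auto simp: S_mat_mk2 T_mat_mk2 lam_sq algebra_simps)
      then show ?thesis
      proof
        assume "w ** S_mat ** T_mat = S_mat"
        then have "s ** v ** s' ** T_mat = s ** u ** S_mat" using u by (simp add: matrix_mul_assoc)
        then show ?thesis using step(2) *(2) by blast
      next
        assume "\<exists>w' \<in> U. w ** S_mat ** T_mat = - w'"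
        then obtain w' where w': "w' \<in> U" "w ** S_mat ** T_mat = - w'" by blast
        then have "s ** v ** s' ** T_mat = - (s ** (u ** w') ** mat 1)" using u by (simp add: matrix_uminus_mult)
        moreover have "u ** w' \<in> pos_words" using pos_words.step[OF step(2)] w'(1) unfolding U_def by blast
        ultimately show ?thesis using *(2) by blast
      qed
    qed
  qed
  then show ?case using *(4) neg by (auto simp: matrix_uminus_mult)
qed

text \<open>Multiplication by S only permutes entries up to sign, so the bound passes from
  \<open>pos_words\<close> to the group. It is a property of the group: the ring itself has
  arbitrarily small nonzero elements.\<close>

lemma HH_entries: "A \<in> HH \<Longrightarrow> A $ i $ j = 0 \<or> \<bar>A $ i $ j\<bar> \<ge> 1"
proof -
  assume "A \<in> HH"
  then obtain v s s' where *: "v \<in> pos_words" "s \<in> {mat 1, S_mat}" "s' \<in> {mat 1, S_mat}"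
    "A = s ** v ** s' \<or> A = - (s ** v ** s')" using HH_normal_form by blast
  define P :: "real^2^2 \<Rightarrow> bool" where "P = (\<lambda>A. \<forall>i j. A $ i $ j = 0 \<or> \<bar>A $ i $ j\<bar> \<ge> 1)"
  have mk: "P (mk2 a b c d) \<longleftrightarrow> (a = 0 \<or> \<bar>a\<bar> \<ge> 1) \<and> (b = 0 \<or> \<bar>b\<bar> \<ge> 1) \<and> (c = 0 \<or> \<bar>c\<bar> \<ge> 1) \<and> (d = 0 \<or> \<bar>d\<bar> \<ge> 1)"
    for a b c d unfolding P_def by (auto simp: forall_2)
  have neg: "P (- M)" if "P M" for M using that by (simp add: P_def)
  have left: "P (S_mat ** M)" and right: "P (M ** S_mat)" if "P M" for M
    using that by (cases M rule: mk2_cases; simp add: S_mat_mk2 mk)+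
  have "P v" unfolding P_def
  proof (intro allI)
    fix i j show "v $ i $ j = 0 \<or> \<bar>v $ i $ j\<bar> \<ge> 1" using pos_words_entries[OF *(1), of i j] by linarith
  qed
  then have "P (s ** v)" using *(2) left by auto
  then have "P (s ** v ** s')" using *(3) right by auto
  then have "P A" using *(4) neg by auto
  then show ?thesis by (simp add: P_def)
qed

text \<open>Diagonal entries with product 1 and absolute values at least 1 are both 1 or both -1, so
  A is unipotent up to sign and commutes with powers of T.\<close>

lemma HH_stabilizer_infinity:
  assumes "A \<in> HH" "A $ 2 $ 1 = 0"
  shows "A ** E_mat k ** adj2 A = E_mat k"
proof -
  obtain a b c d where A: "A = mk2 a b c d" by (rule mk2_cases)
  have c: "c = 0" and ad: "a * d = 1" using assms HH_det[OF assms(1)] by (simp_all add: A)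
  then have "\<bar>a\<bar> \<ge> 1" "\<bar>d\<bar> \<ge> 1" using HH_entries[OF assms(1), of 1 1] HH_entries[OF assms(1), of 2 2]
    by (auto simp: A)
  moreover have "\<bar>a\<bar> * \<bar>d\<bar> = 1" using ad by (simp flip: abs_mult)
  ultimately have "\<bar>a\<bar> = 1" using mult_left_mono[of 1 "\<bar>d\<bar>" "\<bar>a\<bar>"] by simp
  then have "a = 1 \<or> a = -1" by auto
  then show ?thesis using ad by (auto simp: A c E_mat_def)
qed

section \<open>Cusps and widths\<close>

lemma Z_pm_subgroup: "subgroup Z_pm H5"
  by (rule group.subgroupI[OF group_H5]) (auto simp: Z_pm_def inv_H5 adj2_uminus matrix_uminus_mult)

lemma Z_pm_normal: "Z_pm \<lhd> H5"
  by (subst group.normal_inv_iff[OF group_H5])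
    (auto simp: Z_pm_subgroup, auto simp: Z_pm_def inv_H5 matrix_uminus_mult)

lemma group_G5: "group G5"
  unfolding G5_def by (rule normal.factorgroup_is_group[OF Z_pm_normal])

lemma pm_eq: "pm A = {A, - A}"
  by (auto simp: pm_def Z_pm_def r_coset_def matrix_uminus_mult)

lemma pm_uminus: "pm (- A) = pm A"
  by (auto simp: pm_eq)

lemma pm_hom: "pm \<in> hom H5 G5"
  unfolding pm_def[abs_def] G5_def by (rule normal.r_coset_hom_Mod[OF Z_pm_normal])

lemma group_hom_pm: "group_hom H5 G5 pm"
  by (rule group_hom.intro[OF group_H5 group_G5]) (simp add: group_hom_axioms_def pm_hom)

lemma carrier_G5: "carrier G5 = pm ` HH"
  by (simp add: G5_def carrier_FactGroup pm_def)

lemma pm_mult: "A \<in> HH \<Longrightarrow> B \<in> HH \<Longrightarrow> pm (A ** B) = pm A \<otimes>\<^bsub>G5\<^esub> pm B"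
  using group_hom.hom_mult[OF group_hom_pm] by simp

lemma pm_adj2: "A \<in> HH \<Longrightarrow> pm (adj2 A) = inv\<^bsub>G5\<^esub> (pm A)"
  using group_hom.hom_inv[OF group_hom_pm, of A] by (simp add: inv_H5)

lemma pm_T_power: "pm T_mat [^]\<^bsub>G5\<^esub> (n :: nat) = pm (E_mat (int n))"
proof (induction n)
  case 0
  show ?case using group_hom.hom_one[OF group_hom_pm] by simp
next
  case (Suc n)
  have "pm (E_mat (int (Suc n))) = pm (E_mat (int n) ** E_mat 1)"
    by (simp flip: E_mat_add add: add.commute)
  also have "\<dots> = pm (E_mat (int n)) \<otimes>\<^bsub>G5\<^esub> pm T_mat" by (simp add: pm_mult E_mat_1)
  finally show ?case by (simp add: Suc)
qed

lemma pm_conj_E: "g \<in> HH \<Longrightarrow>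
    pm g \<otimes>\<^bsub>G5\<^esub> (pm T_mat [^]\<^bsub>G5\<^esub> (w :: nat)) \<otimes>\<^bsub>G5\<^esub> inv\<^bsub>G5\<^esub> (pm g) = pm (conj_E g (int w))"
  by (simp add: pm_T_power conj_E_def pm_mult pm_adj2)

text \<open>The projective point with homogeneous coordinates (a : c); at (0, 0) it takes the
  default value \<open>None\<close>.\<close>

definition pt :: "real \<Rightarrow> real \<Rightarrow> real option" where
  "pt a c = (if c = 0 then None else Some (a / c))"

lemma moebius_act_pt:
  "(a, c) \<noteq> (0, 0) \<Longrightarrow> moebius_act (mk2 p q r s) (pt a c) = pt (p * a + q * c) (r * a + s * c)"
proof -
  assume nz: "(a, c) \<noteq> (0, 0)"
  show ?thesis
  proof (cases "c = 0")
    case True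
    then show ?thesis using nz by (simp add: pt_def)
  next
    case False
    have num: "p * (a / c) + q = (p * a + q * c) / c" and den: "r * (a / c) + s = (r * a + s * c) / c"
      using False by (simp_all add: add_divide_distrib)
    show ?thesis using False by (simp add: pt_def num den del: times_divide_eq_right)
  qed
qed

lemma pt_eq_iff: "(a, c) \<noteq> (0, 0) \<Longrightarrow> (a', c') \<noteq> (0, 0) \<Longrightarrow> pt a c = pt a' c' \<longleftrightarrow> a * c' = a' * c"
  by (auto simp: pt_def field_simps)

lemma moebius_act_None: "moebius_act A None = pt (A $ 1 $ 1) (A $ 2 $ 1)"
  by (simp add: pt_def)

declare moebius_act.simps [simp del]

lemma conj_E_mk2: "conj_E (mk2 a b c d) k = mk2 (a * d - b * c - of_int k * lam * a * c) (of_int k * lam * a * a)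
     (- of_int k * lam * c * c) (a * d - b * c + of_int k * lam * a * c)"
  by (simp add: conj_E_def E_mat_def algebra_simps)

text \<open>The first column of g is an eigenvector of the conjugate, with eigenvalue 1.\<close>

lemma fixes_point_conj_E:
  assumes "g \<in> HH"
  shows "fixes_point (pm (conj_E g k)) (moebius_act g None)"
proof -
  obtain a b c d where g: "g = mk2 a b c d" by (rule mk2_cases)
  have det: "a * d - b * c = 1" using HH_det[OF assms] by (simp add: g)
  have nz: "(a, c) \<noteq> (0, 0)" using det by auto
  have "a * (1 - k * lam * a * c) + c * (k * lam * a * a) = a"
    "a * (- k * lam * c * c) + c * (1 + k * lam * a * c) = c" by (simp_all add: algebra_simps)
  then show ?thesis unfolding fixes_point_def pm_eq moebius_act_None
    using nz by (auto simp: g conj_E_mk2 det moebius_act_pt pt_eq_iff algebra_simps)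
qed

text \<open>A nontrivial parabolic element fixes one point only, so g and h send infinity to the
  same cusp and differ by an element of its stabiliser. This makes widths independent of the
  conjugator.\<close>

lemma conj_E_eq_of_fixes_point:
  assumes "g \<in> HH" "h \<in> HH" "k \<noteq> 0" "fixes_point (pm (conj_E h k)) (moebius_act g None)"
  shows "conj_E h j = conj_E g j"
proof -
  obtain a b c d where g: "g = mk2 a b c d" by (rule mk2_cases)
  obtain a' b' c' d' where h: "h = mk2 a' b' c' d'" by (rule mk2_cases)
  have det: "a * d - b * c = 1" "a' * d' - b' * c' = 1"
    using HH_det[OF assms(1)] HH_det[OF assms(2)] by (simp_all add: g h)
  have nz: "(a, c) \<noteq> (0, 0)" using det by auto
  define r where "r = of_int k * lam"
  have r: "r \<noteq> 0" using assms(3) lam_gt_1 by (simp add: r_def)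
  define p q where "p = (1 - r * a' * c') * a + r * a' * a' * c" and "q = - r * c' * c' * a + (1 + r * a' * c') * c"
  have "pt p q = pt a c"
    using assms(4) nz unfolding fixes_point_def pm_eq moebius_act_None
    by (auto simp: g h conj_E_mk2 det moebius_act_pt p_def q_def r_def)
  \<comment> \<open>Here (p, q) is the image of the column (a, c); applying the inverse matrix
    recovers (a, c).\<close>
  have "(p, q) \<noteq> (0, 0)"
  proof
    assume "(p, q) = (0, 0)"
    then have "p = 0" "q = 0" by auto
    moreover have "(1 + r * a' * c') * p - r * a' * a' * q = a"
      unfolding p_def q_def by (simp add: algebra_simps)
    moreover have "r * c' * c' * p + (1 - r * a' * c') * q = c"
      unfolding p_def q_def by (simp add: algebra_simps)
    ultimately show False using nz by simp
  qed
  then have "p * c = a * q" using \<open>pt p q = pt a c\<close> nz pt_eq_iff by blast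
  \<comment> \<open>The determinant of the image and the original column is r times a square, so it
    vanishes only if the first columns of g and h are proportional.\<close>
  moreover have "p * c - a * q = r * (a' * c - a * c') ^ 2"
    unfolding p_def q_def by (simp add: power2_eq_square algebra_simps)
  ultimately have "a' * c - a * c' = 0" using r by simp
  then have "(adj2 g ** h) $ 2 $ 1 = 0" by (simp add: g h algebra_simps)
  then have stab: "(adj2 g ** h) ** E_mat j ** adj2 (adj2 g ** h) = E_mat j"
    using assms HH_stabilizer_infinity by simp
  have "conj_E h j = g ** ((adj2 g ** h) ** E_mat j ** adj2 (adj2 g ** h)) ** adj2 g"
    using assms by (simp add: conj_E_def adj2_mult matrix_mul_assoc)
  then show ?thesis unfolding stab by (simp add: conj_E_def)
qed

section \<open>Pulling K back to the Hecke group\<close>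

definition preim :: "(real^2^2) set set \<Rightarrow> (real^2^2) set" where
  "preim K = {A \<in> HH. pm A \<in> K}"

lemma preim_closed:
  assumes "subgroup K G5"
  shows "mat 1 \<in> preim K" "A \<in> preim K \<Longrightarrow> B \<in> preim K \<Longrightarrow> A ** B \<in> preim K"
    "A \<in> preim K \<Longrightarrow> adj2 A \<in> preim K"
  using subgroup.one_closed[OF assms] subgroup.m_closed[OF assms] subgroup.m_inv_closed[OF assms]
    group_hom.hom_one[OF group_hom_pm]
  by (auto simp: preim_def pm_mult pm_adj2)

lemma conj_E_add: "g \<in> HH \<Longrightarrow> conj_E g (j + k) = conj_E g j ** conj_E g k"
  by (simp add: conj_E_def E_mat_add matrix_mul_assoc)

lemma adj2_conj_E: "adj2 (conj_E g k) = conj_E g (- k)"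
  by (simp add: conj_E_def adj2_mult adj2_E_mat matrix_mul_assoc)

lemma preim_conj_E_dvd:
  assumes K: "subgroup K G5" and g: "g \<in> HH" and w: "conj_E g w \<in> preim K" "w dvd m"
  shows "conj_E g m \<in> preim K"
proof -
  have nat: "conj_E g (int n * w) \<in> preim K" for n
  proof (induction n)
    case 0
    show ?case using preim_closed(1)[OF K] g by (simp add: conj_E_def)
  next
    case (Suc n)
    then show ?case using preim_closed(2)[OF K w(1)] g by (simp add: distrib_right conj_E_add)
  qed
  obtain l where m: "m = w * l" using w by blast
  show ?thesis
  proof (cases "l \<ge> 0")
    case True
    then show ?thesis using nat[of "nat l"] by (simp add: m mult.commute)
  next
    case False
    then show ?thesis using preim_closed(3)[OF K nat[of "nat (- l)"]] by (simp add: m adj2_conj_E mult.commute)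
  qed
qed

lemma Nclos_preim:
  assumes K: "subgroup K G5" and "\<And>g. g \<in> HH \<Longrightarrow> conj_E g m \<in> preim K"
  shows "Nclos m \<subseteq> preim K"
proof
  fix A assume "A \<in> Nclos m"
  then show "A \<in> preim K"
  proof (induction rule: Nclos.induct)
    case (step A g k)
    then show ?case using preim_closed(2)[OF K step(3)] preim_conj_E_dvd[OF K step(2) assms(2)] by simp
  qed (rule preim_closed(1)[OF K])
qed

text \<open>Pigeonhole: among the exponents from 0 to the index, two give the same coset of K, and
  their difference is w.\<close>

lemma width_exists:
  assumes K: "subgroup K G5" and fin: "finite (rcosets\<^bsub>G5\<^esub> K)" and g: "g \<in> HH"
  shows "\<exists>w. 0 < w \<and> w \<le> card (rcosets\<^bsub>G5\<^esub> K) \<and> conj_E g (int w) \<in> preim K"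
proof -
  let ?n = "card (rcosets\<^bsub>G5\<^esub> K)"
  define f where "f i = K #>\<^bsub>G5\<^esub> pm (conj_E g (int i))" for i :: nat
  have in_G: "pm (conj_E g k) \<in> carrier G5" for k using g by (simp add: carrier_G5)
  have "f ` {..?n} \<subseteq> rcosets\<^bsub>G5\<^esub> K" unfolding f_def RCOSETS_def using in_G by blast
  then have "card (f ` {..?n}) < card {..?n}" using card_mono[OF fin] by (simp add: less_Suc_eq_le)
  then have "\<not> inj_on f {..?n}" by (rule pigeonhole)
  then obtain i j where ij: "i < j" "j \<le> ?n" "f i = f j"
    unfolding inj_on_def by (metis atMost_iff linorder_neqE_nat)
  have "pm (conj_E g (int j)) \<in> K #>\<^bsub>G5\<^esub> pm (conj_E g (int i))"
    using group.rcos_self[OF group_G5 in_G K, of j] ij(3) unfolding f_def by simp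
  then obtain k where k: "k \<in> K" "pm (conj_E g (int j)) = k \<otimes>\<^bsub>G5\<^esub> pm (conj_E g (int i))"
    unfolding r_coset_def by blast
  have "pm (conj_E g (int (j - i))) = pm (conj_E g (int j)) \<otimes>\<^bsub>G5\<^esub> inv\<^bsub>G5\<^esub> (pm (conj_E g (int i)))"
    using g ij(1) by (simp flip: pm_adj2 pm_mult add: adj2_conj_E flip: conj_E_add)
  also have "\<dots> = k" using k in_G subgroup.mem_carrier[OF K k(1)] group.inv_solve_right'[OF group_G5]
    by metis
  finally have "conj_E g (int (j - i)) \<in> preim K" using k g by (simp add: preim_def)
  then show ?thesis using ij by (intro exI[of _ "j - i"]) auto
qed

text \<open>The least element in \<open>width\<close> ranges over all conjugators;
  \<open>conj_E_eq_of_fixes_point\<close> reduces it to g, and \<open>width_exists\<close>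
  guarantees that a candidate exists.\<close>

lemma width_properties:
  assumes K: "subgroup K G5" and fin: "finite (rcosets\<^bsub>G5\<^esub> K)" and g: "g \<in> HH"
  defines "w \<equiv> width K (moebius_act g None)"
  shows "0 < w" "w \<le> card (rcosets\<^bsub>G5\<^esub> K)" "conj_E g (int w) \<in> preim K"
proof -
  let ?x = "moebius_act g None"
  define P where "P w \<longleftrightarrow> w > 0 \<and> (\<exists>g \<in> carrier G5. \<exists>k \<in> K. fixes_point k ?x \<and>
      k = g \<otimes>\<^bsub>G5\<^esub> (pm T_mat [^]\<^bsub>G5\<^esub> w) \<otimes>\<^bsub>G5\<^esub> inv\<^bsub>G5\<^esub> g)" for w :: nat
  have P_iff: "P w \<longleftrightarrow> w > 0 \<and> conj_E g (int w) \<in> preim K" for w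
  proof
    assume "P w"
    then obtain h where h: "w > 0" "h \<in> HH" "pm (conj_E h (int w)) \<in> K" "fixes_point (pm (conj_E h (int w))) ?x"
      unfolding P_def carrier_G5 by (auto simp: pm_conj_E)
    then have "conj_E h (int w) = conj_E g (int w)" using conj_E_eq_of_fixes_point[OF g h(2) _ h(4)] by simp
    then show "w > 0 \<and> conj_E g (int w) \<in> preim K" using h g by (simp add: preim_def)
  next
    assume "w > 0 \<and> conj_E g (int w) \<in> preim K"
    then show "P w" unfolding P_def carrier_G5 using g fixes_point_conj_E[OF g, of w]
      by (auto simp: preim_def pm_conj_E intro!: bexI[of _ "pm (conj_E g (int w))"] bexI[of _ g])
  qed
  have w: "w = (LEAST w. P w)" unfolding w_def width_def P_def ..
  obtain v where v: "P v" "v \<le> card (rcosets\<^bsub>G5\<^esub> K)" using width_exists[OF K fin g] P_iff by blast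
  have "P w" unfolding w using v(1) by (rule LeastI)
  then show "0 < w" "conj_E g (int w) \<in> preim K" using P_iff by auto
  show "w \<le> card (rcosets\<^bsub>G5\<^esub> K)" using Least_le[of P v] v w by simp
qed

lemma cusps_eq: "cusps = (\<lambda>g. moebius_act g None) ` HH"
  unfolding cusps_def carrier_G5 by (auto simp: pm_eq intro!: imageI)

lemma geometric_level_properties:
  assumes K: "subgroup K G5" and fin: "finite (rcosets\<^bsub>G5\<^esub> K)"
  shows "geometric_level K > 0" "Nclos (int (geometric_level K)) \<subseteq> preim K"
proof -
  \<comment> \<open>The bound by the index makes the set of widths finite, so that its
    \<open>Lcm\<close> is not 0.\<close>
  have "width K ` cusps \<subseteq> {0<..card (rcosets\<^bsub>G5\<^esub> K)}"
    using width_properties(1,2)[OF K fin] by (auto simp: cusps_eq)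
  then have "finite (width K ` cusps)" "0 \<notin> width K ` cusps" by (auto intro: finite_subset)
  then have "geometric_level K \<noteq> 0" unfolding geometric_level_def by (metis Lcm_0_iff)
  then show "geometric_level K > 0" by simp
  show "Nclos (int (geometric_level K)) \<subseteq> preim K"
  proof (rule Nclos_preim[OF K])
    fix g assume g: "g \<in> HH"
    then have "width K (moebius_act g None) dvd geometric_level K"
      unfolding geometric_level_def cusps_eq by (intro dvd_Lcm) auto
    then show "conj_E g (int (geometric_level K)) \<in> preim K"
      using preim_conj_E_dvd[OF K g width_properties(3)[OF K fin g]] by simp
  qed
qed

lemma H_cong_Hprin: "H_cong (of_int n) = Hprin n"
proof -
  have "(\<forall>i j. \<exists>c \<in> Zlam. A $ i $ j - mat 1 $ i $ j = of_int n * c) \<longleftrightarrow> mcong n A (mat 1)" for A :: "real^2^2"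
  proof
    assume "\<forall>i j. \<exists>c \<in> Zlam. A $ i $ j - mat 1 $ i $ j = of_int n * c"
    then obtain c where c: "\<And>i j. c i j \<in> Zlam \<and> A $ i $ j - mat 1 $ i $ j = of_int n * c i j" by metis
    show "mcong n A (mat 1)" unfolding mcong_def
    proof
      show "(\<chi> i j. c i j) \<in> M2Zlam" using c by (simp add: M2Zlam_def)
      show "A = mat 1 + of_int n *\<^sub>R (\<chi> i j. c i j)"
        using c by (simp add: vec_eq_iff algebra_simps)
    qed
  next
    assume "mcong n A (mat 1)"
    then obtain C where "C \<in> M2Zlam" "A = mat 1 + of_int n *\<^sub>R C" unfolding mcong_def by blast
    then show "\<forall>i j. \<exists>c \<in> Zlam. A $ i $ j - mat 1 $ i $ j = of_int n * c" by (auto simp: M2Zlam_def)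
  qed
  then show ?thesis by (simp add: H_cong_def Hprin_def)
qed

lemma G_cong_eq: "G_cong \<tau> = pm ` H_cong \<tau>"
proof -
  have "H_cong \<tau> <#>\<^bsub>H5\<^esub> Z_pm = H_cong \<tau> \<union> uminus ` H_cong \<tau>"
    by (auto simp: set_mult_def Z_pm_def matrix_uminus_mult)
  then show ?thesis by (auto simp: G_cong_def pm_uminus)
qed

lemma G_cong_subset_iff: "G_cong (of_int n) \<subseteq> K \<longleftrightarrow> Hprin n \<subseteq> preim K"
  by (auto simp: G_cong_eq H_cong_Hprin preim_def Hprin_def)

text \<open>A nonzero \<tau> divides a positive integer, its norm up to sign, so integer levels
  suffice.\<close>

lemma congruence_subgroup_iff:
  assumes K: "subgroup K G5"
  shows "congruence_subgroup K \<longleftrightarrow> (\<exists>M > 0. Hprin (int M) \<subseteq> preim K)"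
proof
  assume "congruence_subgroup K"
  then obtain \<tau> where t: "\<tau> \<in> Zlam" "\<tau> \<noteq> 0" "G_cong \<tau> \<subseteq> K" unfolding congruence_subgroup_def by blast
  then obtain M c where M: "(M :: int) > 0" "c \<in> Zlam" "of_int M = \<tau> * c" using Zlam_int_multiple by blast
  have "H_cong (of_int M) \<subseteq> H_cong \<tau>"
    unfolding H_cong_def M(3) using M(2) Zlam_mult by (fastforce simp: mult.assoc)
  then have "G_cong (of_int M) \<subseteq> K" using t(3) unfolding G_cong_eq by blast
  then show "\<exists>M > 0. Hprin (int M) \<subseteq> preim K"
    unfolding G_cong_subset_iff using M(1) by (intro exI[of _ "nat M"]) auto
next
  assume "\<exists>M > 0. Hprin (int M) \<subseteq> preim K"
  then obtain M :: nat where M: "M > 0" "Hprin (int M) \<subseteq> preim K" by blast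
  then have "G_cong (of_int (int M)) \<subseteq> K" unfolding G_cong_subset_iff by blast
  then show "congruence_subgroup K" unfolding congruence_subgroup_def using K M(1)
    by (intro conjI bexI[of _ "of_int (int M)"]) (auto simp del: of_int_of_nat_eq)
qed

text \<open>Serves both cases, with r = m or r = 2 m. An element of H(r) splits into one of H(M) and
  one of N(m), both in the preimage of K.\<close>

lemma congruence_subgroup_covers:
  assumes K: "subgroup K G5" and N: "Nclos (int m) \<subseteq> preim K" and r: "r > 0"
    and cov: "\<And>M. M > 0 \<Longrightarrow> covers (int r) (int m) (int (r * M))"
  shows "congruence_subgroup K \<longleftrightarrow> G_cong (real r) \<subseteq> K"
proof -
  have "Hprin (int r) \<subseteq> preim K" if M: "M > 0" "Hprin (int M) \<subseteq> preim K" for M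
  proof
    fix A assume A: "A \<in> Hprin (int r)"
    then obtain B where B: "B \<in> Nclos (int m)" "A ** adj2 B \<in> Hprin (int (r * M))"
      using cov[OF M(1)] unfolding covers_def by blast
    then have "A ** adj2 B \<in> Hprin (int M)" unfolding Hprin_def by (auto intro: mcong_dvd)
    then have "A ** adj2 B ** B \<in> preim K" using M(2) N B(1) preim_closed(2)[OF K] by blast
    then show "A \<in> preim K" using Nclos_HH[OF B(1)] by simp
  qed
  then show ?thesis
    using congruence_subgroup_iff[OF K] G_cong_subset_iff[of "int r" K] r by auto
qed

theorem proposition5p1:
  fixes K :: "(real^2^2) set set" and m :: nat
  assumes "subgroup K G5"
    and "finite (rcosets\<^bsub>G5\<^esub> K)"
    and "geometric_level K = m"
  shows "(\<not> 4 dvd m \<longrightarrow> (congruence_subgroup K \<longleftrightarrow> G_cong (real m) \<subseteq> K)) \<and>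
         (4 dvd m \<longrightarrow> (congruence_subgroup K \<longleftrightarrow> G_cong (real (2 * m)) \<subseteq> K))"
proof -
  have m: "m > 0" "Nclos (int m) \<subseteq> preim K"
    using geometric_level_properties[OF assms(1,2)] assms(3) by auto
  show ?thesis
  proof (intro conjI impI)
    assume "\<not> 4 dvd m"
    with m(1) show "congruence_subgroup K \<longleftrightarrow> G_cong (real m) \<subseteq> K"
      by (intro congruence_subgroup_covers[OF assms(1) m(2)] covers_not_4_dvd)
  next
    assume "4 dvd m"
    with m(1) show "congruence_subgroup K \<longleftrightarrow> G_cong (real (2 * m)) \<subseteq> K"
      by (intro congruence_subgroup_covers[OF assms(1) m(2)] covers_4_dvd) auto
  qed
qed

end
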